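(* Let $\mathbb F$ be a field of characteristic zero and let $n\geq 1$. Let $Z_n$ be the center of the universal enveloping algebra of the standard filiform Lie algebra $\mathfrak g(n+2)$ over $\mathbb F$, and let $z_1,\ldots,z_n$ and $w_1,\ldots,w_n$ be the elements of $\mathbb F[y_0,\ldots,y_n]$ defined in the context. Then the algebra $Z_n$ has Krull dimension $n$ and the following are valid. (1) The fraction field of $Z_n$ is $$\mathrm{Frac}(Z_n)=\mathbb F(z_1,z_2,\ldots,z_n)=\mathbb F(w_1,w_2,\ldots,w_n).$$ (2) $Z_n\subseteq \mathbb F[y_0^{-1},z_1,z_2,\ldots,z_n]$ and $Z_n\subseteq \mathbb F[y_0^{-1},w_1,\ldots,w_n]$.
   Context: The standard filiform Lie algebra $\mathfrak g(n+2)$ over $\mathbb F$ has basis $x,y_0,y_1,\ldots,y_n$ and nonzero brackets $[x,y_i]=y_{i-1}$ for $1\leq i\leq n$ (so $[x,y_0]=0$ and the $y_i$ commute). By the Poincaré–Birkhoff–Witt Theorem the polynomial algebra $\mathbb F[y_0,\ldots,y_n]$ is a subalgebra of $U(\mathfrak g(n+2))$. In characteristic zero, $Z_n$, the center of $U(\mathfrak g(n+2))$, is viewed as a graded subalgebra of $\mathbb F[y_0,\ldots,y_n]$, namely the set of $f$ with $x(f)=0$, where $x$ is the $\mathbb F$-derivation $x(f)=\sum_{i=0}^{n-1}y_i\,\partial f/\partial y_{i+1}$. Let $\hat f_n$ be the $\mathbb F$-derivation of $\mathbb F[y_0,\ldots,y_n]$ with $\hat f_n(y_i)=(i+1)(n-i)y_{i+1}$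 for $0\leq i\leq n$ (so $\hat f_n(y_n)=0$), and let $\hat h=[x,\hat f_n]$, which is the derivation with $\hat h(y_i)=(n-2i)y_i$. If $u_1,u_2\in Z_n$ are homogeneous $\hat h$-eigenvectors with eigenvalues (weights) $a_1,a_2$ and $0\leq d\leq\min\{a_1,a_2\}$, put $u_{i,0}=u_i$ and $u_{i,k}=\frac{1}{k(a_i-k+1)}\hat f_n(u_{i,k-1})$ for $1\leq k\leq d$, $i\in\{1,2\}$, and define $$u_1\circ_d u_2=\sum_{i=0}^d(-1)^iu_{1,i}u_{2,d-i}.$$ This is an element of $Z_n$, of weight $a_1+a_2-2d$ when nonzero. The element $y_0$ has weight $n$. The first sequence: $z_1=y_0$ and, for $2\leq i\leq n$, $z_i=y_0\circ_i y_0$ if $i$ is even, and $z_i=y_0\circ_1(y_0\circ_{i-1}y_0)$ if $i$ is odd. The second sequence: $w_1=y_0$ and, for $m\geq 2$, $$w_m=\frac{(-1)^m}{m!}y_1^m+\sum_{i=0}^{m-1}\frac{(-1)^i}{i!}y_0^{m-1-i}y_1^iy_{m-i}.$$ *)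

theory Defs
  imports
    "HOL-Algebra.Algebra"
    "HOL-Algebra.Algebraic_Closure_Type"
    "HOL-Library.Poly_Mapping"
    "HOL-Library.Extended_Nat"
    "HOL-Computational_Algebra.Fraction_Field"
begin

section \<open>Free associative algebras and universal enveloping algebras\<close>

text \<open>The free monoid, written additively so that \<open>'b fmon \<Rightarrow>\<^sub>0 'a\<close> carries the
  convolution product and is the free associative algebra on \<open>'b\<close>.\<close>

datatype 'b fmon = FMon (letters: "'b list")

instantiation fmon :: (type) monoid_add
begin

definition zero_fmon :: "'a fmon" where "0 = FMon []"

definition plus_fmon :: "'a fmon \<Rightarrow> 'a fmon \<Rightarrow> 'a fmon" where
  "u + v = FMon (letters u @ letters v)"

instance
  by standard (simp_all add: zero_fmon_def plus_fmon_def)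

end

text \<open>The tensor algebra of the vector space with basis \<open>B\<close>.\<close>

definition free_algebra :: "'b set \<Rightarrow> ('b fmon \<Rightarrow>\<^sub>0 'a::field) ring" where
  "free_algebra B =
     ring_of_type_algebra\<lparr>carrier := {t. \<forall>w\<in>Poly_Mapping.keys t. set (letters w) \<subseteq> B}\<rparr>"

definition deg1 :: "('b \<Rightarrow>\<^sub>0 'a::field) \<Rightarrow> ('b fmon \<Rightarrow>\<^sub>0 'a)" where
  "deg1 u = (\<Sum>b\<in>Poly_Mapping.keys u.
     Poly_Mapping.single (FMon [b]) (Poly_Mapping.lookup u b))"

text \<open>A Lie algebra with basis \<open>B\<close> is given by a bracket on finitely supported
  functions, its elements being the functions supported in \<open>B\<close>.\<close>

definition uea_ideal ::
  "'b set \<Rightarrow> (('b \<Rightarrow>\<^sub>0 'a) \<Rightarrow> ('b \<Rightarrow>\<^sub>0 'a) \<Rightarrow> ('b \<Rightarrow>\<^sub>0 'a::field)) \<Rightarrow> ('b fmon \<Rightarrow>\<^sub>0 'a) set"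
  where
  "uea_ideal B br = Idl\<^bsub>free_algebra B\<^esub>
     {deg1 u * deg1 v - deg1 v * deg1 u - deg1 (br u v) | u v.
        Poly_Mapping.keys u \<subseteq> B \<and> Poly_Mapping.keys v \<subseteq> B}"

definition uea ::
  "'b set \<Rightarrow> (('b \<Rightarrow>\<^sub>0 'a) \<Rightarrow> ('b \<Rightarrow>\<^sub>0 'a) \<Rightarrow> ('b \<Rightarrow>\<^sub>0 'a::field)) \<Rightarrow> ('b fmon \<Rightarrow>\<^sub>0 'a) set ring"
  where
  "uea B br = free_algebra B Quot uea_ideal B br"

definition ring_center :: "('r, 'm) ring_scheme \<Rightarrow> 'r set" where
  "ring_center R = {c \<in> carrier R. \<forall>r\<in>carrier R. c \<otimes>\<^bsub>R\<^esub> r = r \<otimes>\<^bsub>R\<^esub> c}"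

definition krull_dim :: "('r, 'm) ring_scheme \<Rightarrow> enat" where
  "krull_dim R = Sup {enat k | k. \<exists>P :: nat \<Rightarrow> 'r set.
     (\<forall>i\<le>k. primeideal (P i) R) \<and> (\<forall>i<k. P i \<subset> P (Suc i))}"


section \<open>The standard filiform Lie algebra\<close>

datatype fil_basis = Bx | By nat

definition fil_basis_set :: "nat \<Rightarrow> fil_basis set" where
  "fil_basis_set n = insert Bx (By ` {..n})"

text \<open>The bilinear alternating extension of \<open>[x, y\<^sub>i] = y\<^sub>i\<^sub>-\<^sub>1\<close> for \<open>1 \<le> i \<le> n\<close>.\<close>

definition fil_bracket ::
  "nat \<Rightarrow> (fil_basis \<Rightarrow>\<^sub>0 'a) \<Rightarrow> (fil_basis \<Rightarrow>\<^sub>0 'a) \<Rightarrow> (fil_basis \<Rightarrow>\<^sub>0 'a::field)" where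
  "fil_bracket n u v = (\<Sum>i=1..n. Poly_Mapping.single (By (i - 1))
     (Poly_Mapping.lookup u Bx * Poly_Mapping.lookup v (By i)
      - Poly_Mapping.lookup u (By i) * Poly_Mapping.lookup v Bx))"

lemma keys_fil_bracket: "Poly_Mapping.keys (fil_bracket n u v) \<subseteq> fil_basis_set n"
  unfolding fil_bracket_def fil_basis_set_def
  by (rule order_trans[OF keys_sum]) (auto split: if_splits)

lemma fil_bracket_alt: "fil_bracket n u u = 0"
  by (simp add: fil_bracket_def mult.commute)

lemma fil_bracket_lookup:
  "Poly_Mapping.lookup (fil_bracket n u v) Bx = 0"
  "Poly_Mapping.lookup (fil_bracket n u v) (By j) =
     (if j < n then Poly_Mapping.lookup u Bx * Poly_Mapping.lookup v (By (Suc j))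
        - Poly_Mapping.lookup u (By (Suc j)) * Poly_Mapping.lookup v Bx else 0)"
proof -
  show "Poly_Mapping.lookup (fil_bracket n u v) Bx = 0"
    by (simp add: fil_bracket_def lookup_sum lookup_single)
  have "Poly_Mapping.lookup (fil_bracket n u v) (By j) = (\<Sum>i=1..n. if i = Suc j then
      Poly_Mapping.lookup u Bx * Poly_Mapping.lookup v (By i)
        - Poly_Mapping.lookup u (By i) * Poly_Mapping.lookup v Bx else 0)"
    unfolding fil_bracket_def lookup_sum
    by (intro sum.cong) (auto simp: lookup_single when_def)
  then show "Poly_Mapping.lookup (fil_bracket n u v) (By j) =
     (if j < n then Poly_Mapping.lookup u Bx * Poly_Mapping.lookup v (By (Suc j))
        - Poly_Mapping.lookup u (By (Suc j)) * Poly_Mapping.lookup v Bx else 0)"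
    by (simp add: sum.delta Suc_le_eq)
qed

lemma fil_bracket_basis:
  fixes n :: nat
  defines "e \<equiv> (\<lambda>b. Poly_Mapping.single b (1::'a::field))"
  shows "1 \<le> i \<Longrightarrow> i \<le> n \<Longrightarrow> fil_bracket n (e Bx) (e (By i)) = e (By (i - 1))"
    and "fil_bracket n (e Bx) (e (By 0)) = 0"
    and "fil_bracket n (e (By i)) (e (By j)) = 0"
proof -
  show "fil_bracket n (e Bx) (e (By i)) = e (By (i - 1))" if "1 \<le> i" "i \<le> n"
  proof (rule poly_mapping_eqI)
    fix b show "Poly_Mapping.lookup (fil_bracket n (e Bx) (e (By i))) b
        = Poly_Mapping.lookup (e (By (i - 1))) b"
      using that by (cases b) (auto simp: fil_bracket_lookup e_def lookup_single when_def)
  qed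
  show "fil_bracket n (e Bx) (e (By 0)) = 0"
  proof (rule poly_mapping_eqI)
    fix b show "Poly_Mapping.lookup (fil_bracket n (e Bx) (e (By 0))) b = Poly_Mapping.lookup 0 b"
      by (cases b) (auto simp: fil_bracket_lookup e_def lookup_single when_def)
  qed
  show "fil_bracket n (e (By i)) (e (By j)) = 0"
  proof (rule poly_mapping_eqI)
    fix b show "Poly_Mapping.lookup (fil_bracket n (e (By i)) (e (By j))) b = Poly_Mapping.lookup 0 b"
      by (cases b) (auto simp: fil_bracket_lookup e_def lookup_single when_def)
  qed
qed

lemma fil_bracket_jacobi:
  "fil_bracket n u (fil_bracket n v w) + fil_bracket n v (fil_bracket n w u)
     + fil_bracket n w (fil_bracket n u v) = 0"
proof (rule poly_mapping_eqI)
  fix b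
  show "Poly_Mapping.lookup (fil_bracket n u (fil_bracket n v w)
      + fil_bracket n v (fil_bracket n w u) + fil_bracket n w (fil_bracket n u v)) b
      = Poly_Mapping.lookup 0 b"
    by (cases b) (auto simp: lookup_add fil_bracket_lookup algebra_simps)
qed

definition fil_uea :: "nat \<Rightarrow> (fil_basis fmon \<Rightarrow>\<^sub>0 'a::field) set ring" where
  "fil_uea n = uea (fil_basis_set n) (fil_bracket n)"


section \<open>The polynomial algebra in \<open>y\<^sub>0, \<dots>, y\<^sub>n\<close> and its Poincare-Birkhoff-Witt embedding\<close>

type_synonym 'a mpol = "(nat \<Rightarrow>\<^sub>0 nat) \<Rightarrow>\<^sub>0 'a"

definition cst :: "'a::field \<Rightarrow> 'a mpol" where
  "cst c = Poly_Mapping.single 0 c"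

definition yv :: "nat \<Rightarrow> 'a::field mpol" where
  "yv i = Poly_Mapping.single (Poly_Mapping.single i 1) 1"

definition ypolys :: "nat \<Rightarrow> 'a::field mpol set" where
  "ypolys n = {p. \<forall>m\<in>Poly_Mapping.keys p. Poly_Mapping.keys m \<subseteq> {..n}}"

definition pbw_word :: "nat \<Rightarrow> (nat \<Rightarrow>\<^sub>0 nat) \<Rightarrow> fil_basis fmon" where
  "pbw_word n m = FMon (concat (map (\<lambda>i. replicate (Poly_Mapping.lookup m i) (By i)) [0..<Suc n]))"

definition pbw :: "nat \<Rightarrow> 'a::field mpol \<Rightarrow> (fil_basis fmon \<Rightarrow>\<^sub>0 'a) set" where
  "pbw n p = uea_ideal (fil_basis_set n) (fil_bracket n) +>\<^bsub>free_algebra (fil_basis_set n)\<^esub>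
     (\<Sum>m\<in>Poly_Mapping.keys p. Poly_Mapping.single (pbw_word n m) (Poly_Mapping.lookup p m))"

text \<open>The center of the enveloping algebra, viewed inside \<open>\<F>[y\<^sub>0, \<dots>, y\<^sub>n]\<close>. In
  characteristic zero \<^const>\<open>pbw\<close> maps it bijectively onto the center.\<close>

definition Zn :: "nat \<Rightarrow> 'a::field mpol set" where
  "Zn n = {f \<in> ypolys n. pbw n f \<in> ring_center (fil_uea n)}"


section \<open>Derivations and the product \<open>\<circ>\<^sub>d\<close>\<close>

definition pdiff :: "nat \<Rightarrow> 'a::field mpol \<Rightarrow> 'a mpol" where
  "pdiff i p = (\<Sum>m\<in>Poly_Mapping.keys p.
     Poly_Mapping.single (m - Poly_Mapping.single i 1)
       (of_nat (Poly_Mapping.lookup m i) * Poly_Mapping.lookup p m))"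

definition xder :: "nat \<Rightarrow> 'a::field mpol \<Rightarrow> 'a mpol" where
  "xder n p = (\<Sum>i<n. yv i * pdiff (i + 1) p)"

definition fhat :: "nat \<Rightarrow> 'a::field mpol \<Rightarrow> 'a mpol" where
  "fhat n p = (\<Sum>i\<le>n. of_nat ((i + 1) * (n - i)) * yv (i + 1) * pdiff i p)"

lemma pdiff_yv: "pdiff i (yv j) = (if i = j then 1 else 0)"
  by (simp add: pdiff_def yv_def lookup_single when_def flip: single_one)

lemma xder_yv:
  "xder n (yv 0) = 0"
  "i < n \<Longrightarrow> xder n (yv (Suc i)) = yv i"
  by (simp_all add: xder_def pdiff_yv if_distrib sum.delta cong: if_cong)

lemma fhat_yv: "i \<le> n \<Longrightarrow> fhat n (yv i) = of_nat ((i + 1) * (n - i)) * yv (i + 1)"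
  by (simp add: fhat_def pdiff_yv if_distrib sum.delta cong: if_cong)

definition hhat :: "nat \<Rightarrow> 'a::field mpol \<Rightarrow> 'a mpol" where
  "hhat n p = xder n (fhat n p) - fhat n (xder n p)"

text \<open>Meaningful only for a nonzero eigenvector \<open>u\<close> of \<^const>\<open>hhat\<close>, whose eigenvalue is
  unique.\<close>

definition weight :: "nat \<Rightarrow> 'a::field mpol \<Rightarrow> 'a" where
  "weight n u = (THE a. hhat n u = cst a * u)"

primrec fseq :: "nat \<Rightarrow> 'a::field mpol \<Rightarrow> nat \<Rightarrow> 'a mpol" where
  "fseq n u 0 = u"
| "fseq n u (Suc k) =
     cst (1 / (of_nat (Suc k) * (weight n u - of_nat (Suc k) + 1))) * fhat n (fseq n u k)"

definition circ :: "nat \<Rightarrow> nat \<Rightarrow> 'a::field mpol \<Rightarrow> 'a mpol \<Rightarrow> 'a mpol" where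
  "circ n d u1 u2 = (\<Sum>i\<le>d. (-1) ^ i * fseq n u1 i * fseq n u2 (d - i))"


section \<open>The two sequences\<close>

text \<open>Only the indices \<open>1 \<le> i \<le> n\<close> are meaningful.\<close>

definition zs :: "nat \<Rightarrow> nat \<Rightarrow> 'a::field mpol" where
  "zs n i =
     (if i = 1 then yv 0
      else if even i then circ n i (yv 0) (yv 0)
      else circ n 1 (yv 0) (circ n (i - 1) (yv 0) (yv 0)))"

definition ws :: "nat \<Rightarrow> 'a::field mpol" where
  "ws m =
     (if m = 1 then yv 0
      else cst ((-1) ^ m / of_nat (fact m)) * yv 1 ^ m
        + (\<Sum>i<m. cst ((-1) ^ i / of_nat (fact i)) * yv 0 ^ (m - 1 - i) * yv 1 ^ i * yv (m - i)))"


section \<open>Subfields and subalgebras of the field of rational functions\<close>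

abbreviation to_rat :: "'a::field mpol \<Rightarrow> 'a mpol fract" where
  "to_rat p \<equiv> Fract p 1"

definition frac_field_of :: "'a::field mpol set \<Rightarrow> 'a mpol fract set" where
  "frac_field_of S = {Fract a b | a b. a \<in> S \<and> b \<in> S \<and> b \<noteq> 0}"

definition gen_subfield :: "'a::field mpol fract set \<Rightarrow> 'a mpol fract set" where
  "gen_subfield H = generate_field ring_of_type_algebra (range (\<lambda>c. to_rat (cst c)) \<union> H)"

definition gen_subalgebra :: "'a::field mpol fract set \<Rightarrow> 'a mpol fract set" where
  "gen_subalgebra H = generate_ring ring_of_type_algebra (range (\<lambda>c. to_rat (cst c)) \<union> H)"

end

theory Submission
  imports Defs
begin

text \<open>Poincare-Birkhoff-Witt: the enveloping algebra acts on \<open>\<F>[y\<^sub>0, \<dots>, y\<^sub>n, T]\<close>, with \<open>y\<^sub>i\<close> acting by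
  multiplication and \<open>x\<close> by \<open>x + T\<close>, and an ordered word \<open>y\<^sup>m x\<^sup>k\<close> sends \<open>1\<close> to \<open>y\<^sup>m T\<^sup>k\<close>. An element
  commuting with \<open>y\<^sub>1\<close> involves no power of \<open>x\<close>, so the center is the kernel of the derivation \<open>x\<close>.

  An invariant \<open>f\<close> is fixed by \<open>exp (t x)\<close> for every \<open>t\<close>. Taking \<open>t = - y\<^sub>1 / y\<^sub>0\<close> gives
  \<open>f = f (y\<^sub>0, 0, w\<^sub>2 / y\<^sub>0, \<dots>, w\<^sub>n / y\<^sub>0\<^sup>n\<^sup>-\<^sup>1)\<close>, which is the claim for the \<open>w\<^sub>m\<close>. As \<open>z\<^sub>m\<close> is invariant and
  equals \<open>c y\<^sub>0\<^sup>e y\<^sub>m\<close> plus a polynomial in \<open>y\<^sub>0, \<dots>, y\<^sub>m\<^sub>-\<^sub>1\<close>, the same formula expresses the \<open>w\<^sub>m\<close> through the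
  \<open>z\<^sub>m\<close> and \<open>1 / y\<^sub>0\<close>.

  Krull dimension: if \<open>P\<^sub>0 \<subset> \<dots> \<subset> P\<^sub>n\<^sub>+\<^sub>1\<close> were a chain of primes, elements \<open>x\<^sub>i \<in> P\<^sub>i\<^sub>+\<^sub>1 - P\<^sub>i\<close> would be algebraically
  independent; but invariants are determined by their restriction to \<open>y\<^sub>1 = 0\<close>, a polynomial ring in \<open>n\<close>
  variables.\<close>

section \<open>Polynomials\<close>

lemma poly_mapping_sum_single:
  fixes p :: "'b \<Rightarrow>\<^sub>0 'c::comm_monoid_add"
  shows "p = (\<Sum>m\<in>Poly_Mapping.keys p. Poly_Mapping.single m (Poly_Mapping.lookup p m))"
proof (rule poly_mapping_eqI)
  fix k
  have "(\<Sum>m\<in>Poly_Mapping.keys p. Poly_Mapping.lookup p m when m = k) = Poly_Mapping.lookup p k"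
    by (cases "k \<in> Poly_Mapping.keys p") (auto simp: when_def in_keys_iff)
  then show "Poly_Mapping.lookup p k
    = Poly_Mapping.lookup (\<Sum>m\<in>Poly_Mapping.keys p. Poly_Mapping.single m (Poly_Mapping.lookup p m)) k"
    by (simp add: lookup_sum lookup_single)
qed

text \<open>A finitely supported function is a finite sum of monomials, and partial sums keep their
  support in \<open>S\<close>. The rule serves twice: with \<open>S\<close> the monomials in given
  variables, and with \<open>S\<close> the words over a given alphabet.\<close>

lemma poly_mapping_keys_induct [consumes 1, case_names zero single add]:
  fixes p :: "'b \<Rightarrow>\<^sub>0 'c::comm_monoid_add"
  assumes "Poly_Mapping.keys p \<subseteq> S" and "P 0"
    and "\<And>m c. m \<in> S \<Longrightarrow> P (Poly_Mapping.single m c)"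
    and add: "\<And>p q. Poly_Mapping.keys p \<subseteq> S \<Longrightarrow> Poly_Mapping.keys q \<subseteq> S \<Longrightarrow> P p \<Longrightarrow> P q \<Longrightarrow> P (p + q)"
  shows "P p"
proof -
  have "Poly_Mapping.keys (\<Sum>m\<in>A. Poly_Mapping.single m (Poly_Mapping.lookup p m)) \<subseteq> S
    \<and> P (\<Sum>m\<in>A. Poly_Mapping.single m (Poly_Mapping.lookup p m))" if "finite A" "A \<subseteq> S" for A
    using that
  proof (induction A rule: finite_induct)
    case (insert m A)
    have "Poly_Mapping.keys (Poly_Mapping.single m (Poly_Mapping.lookup p m)) \<subseteq> S"
      using insert.prems by simp
    moreover have "P (Poly_Mapping.single m (Poly_Mapping.lookup p m))"
      using assms(3) insert.prems by simp
    ultimately show ?case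
      using insert add
      by (simp add: order_trans[OF keys_add] del: keys_single)
  qed (use assms in simp)
  then show ?thesis
    using poly_mapping_sum_single[of p] assms(1) by (metis finite_keys)
qed

lemmas poly_mapping_single_induct [case_names zero single add] =
  poly_mapping_keys_induct[OF subset_UNIV, simplified]

lemma keys_add_exp:
  "Poly_Mapping.keys (a + b :: 'b \<Rightarrow>\<^sub>0 nat) = Poly_Mapping.keys a \<union> Poly_Mapping.keys b"
  by (auto simp: in_keys_iff lookup_add)

lemma cst_simps [simp]:
  fixes a b :: "'a::field"
  shows "cst 0 = 0" "cst 1 = 1" "cst (a + b) = cst a + cst b" "cst (a * b) = cst a * cst b"
  "cst (- a) = - cst a" "cst (a - b) = cst a - cst b" "cst (of_nat k) = of_nat k"
  "cst (a ^ k) = cst a ^ k" "cst (numeral w) = numeral w"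
proof -
  have m: "cst (a * b) = cst a * cst b" for a b :: 'a
    by (simp add: cst_def mult_single)
  show "cst (a * b) = cst a * cst b"
    by (rule m)
  show "cst (a ^ k) = cst a ^ k"
    by (induction k) (simp_all add: m, simp add: cst_def)
qed (simp_all add: cst_def single_add single_uminus single_diff)

lemma cst_eq_iff [simp]: "cst a = cst b \<longleftrightarrow> a = b"
  unfolding cst_def by (meson inj_single injD)

lemma cst_eq_0_iff [simp]: "cst a = 0 \<longleftrightarrow> a = 0"
  using cst_eq_iff[of a 0] by (simp del: cst_eq_iff)

lemma yv_neq_0 [simp]: "yv i \<noteq> 0"
  by (metis yv_def keys_single keys_zero insert_not_empty zero_neq_one)

text \<open>The variables form an arbitrary set, since later arguments drop a single variable (y_1,
  or the lowest one of a chain) or adjoin the auxiliary variable \<open>yv (Suc n)\<close>.\<close>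

definition polys_in :: "nat set \<Rightarrow> 'a::field mpol set" where
  "polys_in V = {p. \<forall>m\<in>Poly_Mapping.keys p. Poly_Mapping.keys m \<subseteq> V}"

lemma ypolys_eq: "ypolys n = polys_in {..n}"
  by (simp add: ypolys_def polys_in_def)

lemma polys_in_UNIV [simp]: "p \<in> polys_in UNIV"
  by (simp add: polys_in_def)

lemma polys_in_mono: "V \<subseteq> W \<Longrightarrow> p \<in> polys_in V \<Longrightarrow> p \<in> polys_in W"
  by (auto simp: polys_in_def)

lemma polys_in_single: "Poly_Mapping.keys m \<subseteq> V \<Longrightarrow> Poly_Mapping.single m c \<in> polys_in V"
  by (simp add: polys_in_def)

lemma polys_in_0 [simp]: "0 \<in> polys_in V"
  by (simp add: polys_in_def)

lemma polys_in_cst [simp]: "cst c \<in> polys_in V"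
  by (simp add: polys_in_def cst_def)

lemma polys_in_1 [simp]: "1 \<in> polys_in V"
  by (simp add: polys_in_def)

lemma polys_in_yv [simp]: "i \<in> V \<Longrightarrow> yv i \<in> polys_in V"
  by (simp add: polys_in_def yv_def)

lemma polys_in_add: "p \<in> polys_in V \<Longrightarrow> q \<in> polys_in V \<Longrightarrow> p + q \<in> polys_in V"
  using keys_add[of p q] by (force simp: polys_in_def)

lemma polys_in_mult: "p \<in> polys_in V \<Longrightarrow> q \<in> polys_in V \<Longrightarrow> p * q \<in> polys_in V"
  using keys_mult[of p q] by (force simp: polys_in_def keys_add_exp)

lemma polys_in_uminus: "p \<in> polys_in V \<Longrightarrow> - p \<in> polys_in V"
  by (simp add: polys_in_def in_keys_iff)

lemma polys_in_diff: "p \<in> polys_in V \<Longrightarrow> q \<in> polys_in V \<Longrightarrow> p - q \<in> polys_in V"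
  using polys_in_add[OF _ polys_in_uminus] by fastforce

lemma polys_in_power: "p \<in> polys_in V \<Longrightarrow> p ^ k \<in> polys_in V"
  by (induction k) (simp_all add: polys_in_mult)

lemma polys_in_of_nat [simp]: "of_nat k \<in> polys_in V"
  using polys_in_cst[of "of_nat k" V] by simp

lemma polys_in_sum: "(\<And>i. i \<in> A \<Longrightarrow> f i \<in> polys_in V) \<Longrightarrow> sum f A \<in> polys_in V"
  by (induction A rule: infinite_finite_induct) (auto intro: polys_in_add)

lemma polys_in_prod: "(\<And>i. i \<in> A \<Longrightarrow> f i \<in> polys_in V) \<Longrightarrow> prod f A \<in> polys_in V"
  by (induction A rule: infinite_finite_induct) (auto intro: polys_in_mult)

lemmas polys_in_intros = polys_in_add polys_in_mult polys_in_uminus polys_in_diff polys_in_power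
  polys_in_sum polys_in_prod

text \<open>A monomial is built by multiplying a constant by one variable at a time, which is
  induction on its total degree; sums of monomials then give every polynomial in the variables
  \<open>V\<close>.\<close>

lemma polys_in_induct [consumes 1, case_names cst yv add]:
  fixes p :: "'a::field mpol"
  assumes "p \<in> polys_in V"
    and cst: "\<And>c. P (cst c)"
    and yv: "\<And>i p. i \<in> V \<Longrightarrow> p \<in> polys_in V \<Longrightarrow> P p \<Longrightarrow> P (yv i * p)"
    and add: "\<And>p q. p \<in> polys_in V \<Longrightarrow> q \<in> polys_in V \<Longrightarrow> P p \<Longrightarrow> P q \<Longrightarrow> P (p + q)"
  shows "P p"
proof -
  have mon: "P (Poly_Mapping.single m c)" if "Poly_Mapping.keys m \<subseteq> V" for m and c :: 'a
    using that
  proof (induction "\<Sum>i\<in>Poly_Mapping.keys m. Poly_Mapping.lookup m i" arbitrary: m)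
    case 0
    then have "m = 0"
      by (intro poly_mapping_eqI) (metis finite_keys in_keys_iff sum_eq_0_iff lookup_zero)
    then show ?case using cst[of c] by (simp add: cst_def)
  next
    case (Suc k)
    then obtain i where i: "i \<in> Poly_Mapping.keys m"
      by (metis Zero_not_Suc all_not_in_conv sum.empty)
    define m' where "m' = m - Poly_Mapping.single i 1"
    have m: "m = Poly_Mapping.single i 1 + m'"
      using i by (intro poly_mapping_eqI)
        (auto simp: m'_def lookup_add lookup_minus lookup_single when_def in_keys_iff)
    have sub: "Poly_Mapping.keys m' \<subseteq> Poly_Mapping.keys m"
      unfolding m keys_add_exp by auto
    have "(\<Sum>j\<in>Poly_Mapping.keys m. Poly_Mapping.lookup m j)
        = (\<Sum>j\<in>Poly_Mapping.keys m. (1 when i = j) + Poly_Mapping.lookup m' j)"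
      by (intro sum.cong refl) (subst m, simp add: lookup_add lookup_single)
    also have "\<dots> = 1 + (\<Sum>j\<in>Poly_Mapping.keys m. Poly_Mapping.lookup m' j)"
      using i by (simp add: sum.distrib when_def)
    also have "(\<Sum>j\<in>Poly_Mapping.keys m. Poly_Mapping.lookup m' j)
        = (\<Sum>j\<in>Poly_Mapping.keys m'. Poly_Mapping.lookup m' j)"
      using sub by (intro sum.mono_neutral_right) (auto simp: in_keys_iff)
    finally have "k = (\<Sum>j\<in>Poly_Mapping.keys m'. Poly_Mapping.lookup m' j)"
      using Suc(2) by simp
    then have "P (Poly_Mapping.single m' c)"
      using Suc sub by (metis order_trans)
    then have "P (yv i * Poly_Mapping.single m' c)"
      using sub i Suc.prems by (intro yv) (auto intro!: polys_in_single)
    then show ?case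
      by (subst m) (simp add: yv_def mult_single)
  qed
  have "Poly_Mapping.keys p \<subseteq> {m. Poly_Mapping.keys m \<subseteq> V}"
    using assms(1) by (auto simp: polys_in_def)
  then show ?thesis
  proof (induction p rule: poly_mapping_keys_induct)
    case zero
    then show ?case using cst[of 0] by simp
  next
    case (single m c)
    then show ?case by (simp add: mon)
  next
    case (add p q)
    then show ?case by (intro assms(4)) (auto simp: polys_in_def)
  qed
qed

lemmas mpol_induct [case_names cst yv add] = polys_in_induct[OF polys_in_UNIV, simplified]

subsection \<open>Evaluation\<close>

text \<open>Evaluation is abstracted over its target because values are needed both in polynomials
  (\<open>pc\<close>) and in rational functions (\<open>fr\<close>).\<close>

locale scalar_hom =
  fixes h :: "'a::field \<Rightarrow> 'b::comm_ring_1"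
  assumes h_1 [simp]: "h 1 = 1"
    and h_add: "h (a + b) = h a + h b"
    and h_mult: "h (a * b) = h a * h b"
begin

lemma h_0 [simp]: "h 0 = 0"
  using h_add[of 0 0] by simp

definition ev :: "(nat \<Rightarrow> 'b) \<Rightarrow> 'a mpol \<Rightarrow> 'b" where
  "ev g p = (\<Sum>m\<in>Poly_Mapping.keys p. h (Poly_Mapping.lookup p m) *
     (\<Prod>i\<in>Poly_Mapping.keys m. g i ^ Poly_Mapping.lookup m i))"

lemma ev_add: "ev g (p + q) = ev g p + ev g q"
  unfolding ev_def by (rule setsum_keys_plus_distrib) (simp_all add: h_add distrib_right)

lemma ev_single:
  "ev g (Poly_Mapping.single m c) = h c * (\<Prod>i\<in>Poly_Mapping.keys m. g i ^ Poly_Mapping.lookup m i)"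
  by (simp add: ev_def)

lemma ev_cst [simp]: "ev g (cst c) = h c"
  by (simp add: cst_def ev_single)

lemma ev_0 [simp]: "ev g 0 = 0"
  by (simp add: ev_def)

lemma ev_1 [simp]: "ev g 1 = 1"
  using ev_cst[of g 1] by (simp del: ev_cst)

lemma ev_yv [simp]: "ev g (yv i) = g i"
  by (simp add: yv_def ev_single)

lemma prod_keys_add:
  "(\<Prod>i\<in>Poly_Mapping.keys (a + b). (g i :: 'b) ^ Poly_Mapping.lookup (a + b) i)
    = (\<Prod>i\<in>Poly_Mapping.keys a. g i ^ Poly_Mapping.lookup a i) *
      (\<Prod>i\<in>Poly_Mapping.keys b. g i ^ Poly_Mapping.lookup b i)"
proof -
  let ?K = "Poly_Mapping.keys a \<union> Poly_Mapping.keys b"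
  have "(\<Prod>i\<in>Poly_Mapping.keys c. g i ^ Poly_Mapping.lookup c i) = (\<Prod>i\<in>?K. g i ^ Poly_Mapping.lookup c i)"
    if "Poly_Mapping.keys c \<subseteq> ?K" for c
    using that by (intro prod.mono_neutral_left) (auto simp: in_keys_iff)
  then show ?thesis
    by (simp add: keys_add_exp lookup_add power_add prod.distrib)
qed

lemma ev_mult: "ev g (p * q) = ev g p * ev g q"
proof (induction p rule: poly_mapping_single_induct)
  case (single m c)
  show ?case
  proof (induction q rule: poly_mapping_single_induct)
    case (single m' c')
    then show ?case
      by (simp only: mult_single ev_single prod_keys_add h_mult mult_ac)
  qed (simp_all add: ev_add algebra_simps)
qed (simp_all add: ev_add algebra_simps)

lemma ev_uminus: "ev g (- p) = - ev g p"
  using ev_add[of g p "- p"] by (simp add: eq_neg_iff_add_eq_0 add.commute)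

lemma ev_diff: "ev g (p - q) = ev g p - ev g q"
  using ev_add[of g p "- q"] by (simp add: ev_uminus)

lemma ev_power: "ev g (p ^ k) = ev g p ^ k"
  by (induction k) (simp_all add: ev_mult)

lemma ev_sum: "ev g (sum f A) = (\<Sum>x\<in>A. ev g (f x))"
  by (induction A rule: infinite_finite_induct) (simp_all add: ev_add)

lemma ev_prod: "ev g (prod f A) = (\<Prod>x\<in>A. ev g (f x))"
  by (induction A rule: infinite_finite_induct) (simp_all add: ev_mult)

lemma ev_of_nat: "ev g (of_nat k) = of_nat k"
  by (induction k) (simp_all add: ev_add)

lemmas ev_hom = ev_add ev_mult ev_uminus ev_diff ev_power ev_sum ev_prod ev_of_nat

text \<open>The universal property of a polynomial ring. Equalities between substitutions, such as
  \<open>ev_cong\<close> and \<open>ev_comp\<close>, reduce through it to the variables.\<close>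

lemma ev_unique:
  assumes "p \<in> polys_in V"
    and "\<And>p q. f (p + q) = f p + f q" and "\<And>p q. f (p * q) = f p * f q"
    and "\<And>c. f (cst c) = h c" and "\<And>i. i \<in> V \<Longrightarrow> f (yv i) = g i"
  shows "f p = ev g p"
  using assms(1) by (induction p rule: polys_in_induct) (simp_all add: assms ev_add ev_mult)

lemma ev_cong:
  assumes "p \<in> polys_in V" and "\<And>i. i \<in> V \<Longrightarrow> g i = g' i"
  shows "ev g p = ev g' p"
  using assms by (intro ev_unique) (auto simp: ev_hom)

lemma ev_closed:
  assumes "p \<in> polys_in V" and "\<And>i. i \<in> V \<Longrightarrow> g i \<in> S" and "range h \<subseteq> S"
    and "\<And>a b. a \<in> S \<Longrightarrow> b \<in> S \<Longrightarrow> a + b \<in> S" and "\<And>a b. a \<in> S \<Longrightarrow> b \<in> S \<Longrightarrow> a * b \<in> S"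
  shows "ev g p \<in> S"
  using assms(1) by (induction p rule: polys_in_induct) (use assms in \<open>auto simp: ev_hom\<close>)

end

interpretation pc: scalar_hom "cst :: 'a::field \<Rightarrow> 'a mpol"
  by standard simp_all

lemma pc_ev_in_polys_in:
  "p \<in> polys_in V \<Longrightarrow> (\<And>i. i \<in> V \<Longrightarrow> g i \<in> polys_in W) \<Longrightarrow> pc.ev g p \<in> polys_in W"
  by (rule pc.ev_closed) (auto intro: polys_in_intros)

lemma (in scalar_hom) ev_comp: "ev g (pc.ev f p) = ev (\<lambda>i. ev g (f i)) p"
  by (rule ev_unique[OF polys_in_UNIV]) (simp_all add: ev_hom pc.ev_hom)

lemma to_rat_add: "to_rat (p + q) = to_rat p + to_rat q"
  and to_rat_mult: "to_rat (p * q) = to_rat p * to_rat q"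
  and to_rat_uminus: "to_rat (- p) = - to_rat p"
  and to_rat_1: "to_rat 1 = 1"
  and to_rat_0: "to_rat 0 = 0"
  by (simp_all add: One_fract_def Zero_fract_def)

lemma to_rat_eq_0_iff: "to_rat p = 0 \<longleftrightarrow> p = 0"
  by (simp add: Zero_fract_def eq_fract)

interpretation fr: scalar_hom "\<lambda>c :: 'a::field. to_rat (cst c)"
  by standard (simp_all add: to_rat_1)

lemma fr_ev_yv: "fr.ev (\<lambda>i. to_rat (yv i)) p = to_rat p"
  by (rule sym, rule fr.ev_unique[OF polys_in_UNIV]) simp_all

subsection \<open>Derivations\<close>

definition derivation :: "('a::field mpol \<Rightarrow> 'a mpol) \<Rightarrow> bool" where
  "derivation D \<longleftrightarrow> (\<forall>p q. D (p + q) = D p + D q) \<and> (\<forall>p q. D (p * q) = D p * q + p * D q)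
     \<and> (\<forall>c. D (cst c) = 0)"

lemma derivationD:
  assumes "derivation D"
  shows "D (p + q) = D p + D q" and "D (p * q) = D p * q + p * D q" and "D (cst c) = 0"
    and "D 0 = 0" and "D 1 = 0" and "D (- p) = - D p" and "D (p - q) = D p - D q"
    and "D (of_nat k) = 0" and "D (cst c * p) = cst c * D p"
    and "D (numeral w) = 0"
proof -
  show D: "D (p + q) = D p + D q" "D (p * q) = D p * q + p * D q" "D (cst c) = 0" for p q c
    using assms by (simp_all add: derivation_def)
  show "D 0 = 0" "D 1 = 0" and of_nat: "D (of_nat k) = 0" for k
    using D(3)[of 0] D(3)[of 1] D(3)[of "of_nat k"] by simp_all
  show "D (numeral w) = 0"
    using of_nat[of "numeral w"] by simp
  show m: "D (- p) = - D p" for p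
    using D(1)[of p "- p"] \<open>D 0 = 0\<close> by (simp add: eq_neg_iff_add_eq_0 add.commute)
  show "D (p - q) = D p - D q"
    using D(1)[of p "- q"] m[of q] by simp
  show "D (cst c * p) = cst c * D p"
    by (simp add: D)
qed

lemma derivation_sum: "derivation D \<Longrightarrow> D (sum f A) = (\<Sum>x\<in>A. D (f x))"
  by (induction A rule: infinite_finite_induct) (simp_all add: derivationD)

lemma derivation_power: "derivation D \<Longrightarrow> D (p ^ k) = of_nat k * p ^ (k - 1) * D p"
proof (induction k)
  case (Suc k)
  then show ?case by (cases k) (simp_all add: derivationD algebra_simps)
qed (simp add: derivationD)

lemma derivation_eqI:
  assumes "derivation D" and "derivation E" and "p \<in> polys_in V" and "\<And>i. i \<in> V \<Longrightarrow> D (yv i) = E (yv i)"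
  shows "D p = E p"
  using assms(3) by (induction p rule: polys_in_induct) (simp_all add: assms derivationD)

lemma derivation_lincomb:
  "(\<And>i. i \<in> A \<Longrightarrow> derivation (D i)) \<Longrightarrow> derivation (\<lambda>p. \<Sum>i\<in>A. a i * D i p)"
  unfolding derivation_def
  by (simp add: sum.distrib distrib_left sum_distrib_left sum_distrib_right mult_ac)

lemma derivation_commutator:
  "derivation D \<Longrightarrow> derivation E \<Longrightarrow> derivation (\<lambda>p. D (E p) - E (D p))"
  unfolding derivation_def[of "\<lambda>p. D (E p) - E (D p)"] by (simp add: derivationD algebra_simps)

lemma lookup_pdiff:
  "Poly_Mapping.lookup (pdiff i p) m
    = of_nat (Suc (Poly_Mapping.lookup m i)) * Poly_Mapping.lookup p (m + Poly_Mapping.single i 1)"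
proof -
  let ?e = "Poly_Mapping.single i (1::nat)"
  have "(of_nat (Poly_Mapping.lookup k i) * Poly_Mapping.lookup p k when k - ?e = m)
      = (if k = m + ?e then of_nat (Suc (Poly_Mapping.lookup m i)) * Poly_Mapping.lookup p (m + ?e) else 0)" for k
  proof (cases "k = m + ?e")
    case True
    then show ?thesis by (simp add: lookup_add)
  next
    case False
    \<comment> \<open>Subtraction of exponents is truncated, so another \<open>k\<close> may satisfy
      \<open>k - ?e = m\<close>, but only with exponent zero at \<open>i\<close>, and then its
      coefficient vanishes.\<close>
    have "Poly_Mapping.lookup k i = 0" if "k - ?e = m"
    proof (rule ccontr)
      assume "Poly_Mapping.lookup k i \<noteq> 0"
      then have "k = m + ?e" unfolding that[symmetric]
        by (intro poly_mapping_eqI) (auto simp: lookup_add lookup_minus lookup_single when_def)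
      then show False using False by simp
    qed
    then show ?thesis using False by (auto simp: when_def)
  qed
  then show ?thesis
    unfolding pdiff_def lookup_sum lookup_single
    by (simp add: in_keys_iff)
qed

lemma pdiff_add: "pdiff i (p + q) = pdiff i p + pdiff i q"
  by (rule poly_mapping_eqI) (simp add: lookup_pdiff lookup_add distrib_left)

lemma pdiff_single:
  "pdiff i (Poly_Mapping.single m c) = Poly_Mapping.single (m - Poly_Mapping.single i 1)
     (of_nat (Poly_Mapping.lookup m i) * c)"
  by (simp add: pdiff_def)

lemma pdiff_single_mult:
  "pdiff i (Poly_Mapping.single a c * Poly_Mapping.single b d)
    = pdiff i (Poly_Mapping.single a c) * Poly_Mapping.single b d
      + Poly_Mapping.single a c * pdiff i (Poly_Mapping.single b d)"
proof -
  let ?e = "Poly_Mapping.single i (1::nat)"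
  \<comment> \<open>Truncated subtraction agrees with this rearrangement when \<open>i\<close>
    occurs in \<open>k\<close>; otherwise the accompanying coefficient is zero and the exponent does
    not matter.\<close>
  have e: "k - ?e + l = k + l - ?e" if "Poly_Mapping.lookup k i \<noteq> 0" for k l
    using that by (intro poly_mapping_eqI) (auto simp: lookup_add lookup_minus lookup_single when_def)
  have "Poly_Mapping.single (a - ?e + b) (of_nat (Poly_Mapping.lookup a i) * c * d)
     = Poly_Mapping.single (a + b - ?e) (of_nat (Poly_Mapping.lookup a i) * c * d)"
    by (cases "Poly_Mapping.lookup a i = 0") (simp_all only: e of_nat_0 mult_zero_left single_zero not_False_eq_True)
  moreover have "Poly_Mapping.single (a + (b - ?e)) (of_nat (Poly_Mapping.lookup b i) * c * d)
     = Poly_Mapping.single (a + b - ?e) (of_nat (Poly_Mapping.lookup b i) * c * d)"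
    by (cases "Poly_Mapping.lookup b i = 0") (simp_all only: e[of b a] add.commute[of a] of_nat_0 mult_zero_left single_zero not_False_eq_True)
  ultimately show ?thesis
    by (simp add: mult_single pdiff_single lookup_add distrib_left distrib_right single_add ac_simps)
qed

lemma derivation_pdiff: "derivation (pdiff i)"
proof -
  have "pdiff i (p * q) = pdiff i p * q + p * pdiff i q" for p q :: "'a mpol"
  proof (induction p rule: poly_mapping_single_induct)
    case zero
    then show ?case by (simp add: pdiff_def)
  next
    case (single m c)
    show ?case
    proof (induction q rule: poly_mapping_single_induct)
      case zero
      then show ?case by (simp add: pdiff_def)
    next
      case (single m' c')
      then show ?case by (rule pdiff_single_mult)
    qed (simp add: pdiff_add algebra_simps)
  qed (simp add: pdiff_add algebra_simps)
  then show ?thesis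
    by (simp add: derivation_def pdiff_add) (simp add: cst_def pdiff_single)
qed

lemma derivation_xder: "derivation (xder n)"
  unfolding xder_def by (intro derivation_lincomb derivation_pdiff)

lemma derivation_fhat: "derivation (fhat n)"
  unfolding fhat_def by (intro derivation_lincomb derivation_pdiff)

lemma derivation_hhat: "derivation (hhat n)"
  unfolding hhat_def by (intro derivation_commutator derivation_xder derivation_fhat)

lemma derivation_closed:
  assumes "derivation D" and "p \<in> polys_in V" and "V \<subseteq> W" and "\<And>i. i \<in> V \<Longrightarrow> D (yv i) \<in> polys_in W"
  shows "D p \<in> polys_in W"
  using assms(2) by (induction p rule: polys_in_induct)
    (use assms polys_in_mono[OF \<open>V \<subseteq> W\<close>] in \<open>auto simp: derivationD intro!: polys_in_intros\<close>)

lemma xder_yv_if: "xder n (yv j) = (if j \<noteq> 0 \<and> j \<le> n then yv (j - 1) else 0)"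
proof (cases "j \<noteq> 0 \<and> j \<le> n")
  case True
  then obtain i where "j = Suc i" "i < n" by (cases j) auto
  then show ?thesis by (simp add: xder_yv)
next
  case False
  then have "\<forall>i<n. i + 1 \<noteq> j" by auto
  then show ?thesis using False by (auto simp: xder_def pdiff_yv intro!: sum.neutral)
qed

lemma xder_closed: "p \<in> polys_in {..m} \<Longrightarrow> xder n p \<in> polys_in {..m}"
  by (erule derivation_closed[OF derivation_xder]) (auto simp: xder_yv_if)

text \<open>In characteristic zero the factor \<open>of_nat (Suc _)\<close> in
  \<open>lookup_pdiff\<close> is nonzero, so a vanishing derivative kills the coefficient of every
  monomial that contains the variable \<open>i\<close>.\<close>

lemma pdiff_eq_0_iff:
  fixes p :: "'a::field_char_0 mpol"
  assumes "p \<in> polys_in (insert i V)" and "pdiff i p = 0"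
  shows "p \<in> polys_in V"
  unfolding polys_in_def
proof (intro CollectI ballI subsetI)
  fix m j assume m: "m \<in> Poly_Mapping.keys p" and j: "j \<in> Poly_Mapping.keys m"
  have "i \<notin> Poly_Mapping.keys m"
  proof
    assume i: "i \<in> Poly_Mapping.keys m"
    then have "m = (m - Poly_Mapping.single i 1) + Poly_Mapping.single i 1"
      by (intro poly_mapping_eqI)
        (auto simp: lookup_add lookup_minus lookup_single when_def in_keys_iff)
    then have "Poly_Mapping.lookup p m = 0"
      using assms(2) lookup_pdiff[of i p "m - Poly_Mapping.single i 1"]
      by (metis lookup_zero mult_eq_0_iff of_nat_eq_0_iff old.nat.distinct(2))
    then show False using m by (simp add: in_keys_iff)
  qed
  then show "j \<in> V" using assms(1) m j by (auto simp: polys_in_def)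
qed

section \<open>The enveloping algebra acting on polynomials\<close>

lemma ring_of_type_algebra_simps [simp]:
  "x \<otimes>\<^bsub>ring_of_type_algebra\<^esub> y = x * y" "x \<oplus>\<^bsub>ring_of_type_algebra\<^esub> y = x + y"
  "\<one>\<^bsub>ring_of_type_algebra\<^esub> = 1" "\<zero>\<^bsub>ring_of_type_algebra\<^esub> = 0"
  by (simp_all add: ring_of_type_algebra_def)

section \<open>The free algebra and the ideal of the enveloping relations\<close>

definition words_in :: "'b set \<Rightarrow> ('b fmon \<Rightarrow>\<^sub>0 'a::field) set" where
  "words_in B = {t. \<forall>w\<in>Poly_Mapping.keys t. set (letters w) \<subseteq> B}"

lemma free_algebra_simps [simp]:
  shows carrier_free_algebra: "carrier (free_algebra B) = words_in B"
    and "s \<otimes>\<^bsub>free_algebra B\<^esub> t = s * t" and "s \<oplus>\<^bsub>free_algebra B\<^esub> t = s + t"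
    and "\<one>\<^bsub>free_algebra B\<^esub> = 1" and "\<zero>\<^bsub>free_algebra B\<^esub> = 0"
  by (simp_all add: free_algebra_def ring_of_type_algebra_def words_in_def)

lemma words_in_0 [simp]: "0 \<in> words_in B"
  by (simp add: words_in_def)

lemma words_in_1 [simp]: "1 \<in> words_in B"
  by (simp add: words_in_def zero_fmon_def)

lemma words_in_single: "set l \<subseteq> B \<Longrightarrow> Poly_Mapping.single (FMon l) c \<in> words_in B"
  by (simp add: words_in_def)

lemma words_in_add: "s \<in> words_in B \<Longrightarrow> t \<in> words_in B \<Longrightarrow> s + t \<in> words_in B"
  using keys_add[of s t] by (force simp: words_in_def)

lemma words_in_uminus: "t \<in> words_in B \<Longrightarrow> - t \<in> words_in B"
  by (simp add: words_in_def in_keys_iff)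

lemma words_in_diff: "s \<in> words_in B \<Longrightarrow> t \<in> words_in B \<Longrightarrow> s - t \<in> words_in B"
  using words_in_add[OF _ words_in_uminus] by fastforce

lemma words_in_mult: "s \<in> words_in B \<Longrightarrow> t \<in> words_in B \<Longrightarrow> s * t \<in> words_in B"
  using keys_mult[of s t] by (force simp: words_in_def plus_fmon_def)

lemma words_in_sum: "(\<And>i. i \<in> A \<Longrightarrow> f i \<in> words_in B) \<Longrightarrow> sum f A \<in> words_in B"
  by (induction A rule: infinite_finite_induct) (auto intro: words_in_add)

lemma ring_free_algebra: "ring (free_algebra B)"
proof (rule ringI)
  show "abelian_group (free_algebra B)"
  proof (rule abelian_groupI)
    fix x assume "x \<in> carrier (free_algebra B)"
    then show "\<exists>y\<in>carrier (free_algebra B). y \<oplus>\<^bsub>free_algebra B\<^esub> x = \<zero>\<^bsub>free_algebra B\<^esub>"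
      unfolding carrier_free_algebra by (intro bexI[of _ "- x"]) (simp_all add: words_in_uminus)
  qed (unfold carrier_free_algebra, simp_all add: words_in_add add_ac)
  show "Group.monoid (free_algebra B)"
    by (rule monoidI) (unfold carrier_free_algebra, simp_all add: words_in_mult mult.assoc)
qed (simp_all add: algebra_simps)

lemma a_inv_free_algebra: "t \<in> words_in B \<Longrightarrow> \<ominus>\<^bsub>free_algebra B\<^esub> t = - t"
  by (rule abelian_group.minus_equality[OF ring.is_abelian_group[OF ring_free_algebra]])
    (unfold carrier_free_algebra, simp_all add: words_in_uminus)

lemma deg1_in: "Poly_Mapping.keys u \<subseteq> B \<Longrightarrow> deg1 u \<in> words_in B"
  unfolding deg1_def by (intro words_in_sum words_in_single) auto

lemma deg1_single: "deg1 (Poly_Mapping.single b c) = Poly_Mapping.single (FMon [b]) c"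
  by (simp add: deg1_def)

abbreviation fil_ideal :: "nat \<Rightarrow> (fil_basis fmon \<Rightarrow>\<^sub>0 'a::field) set" where
  "fil_ideal n \<equiv> uea_ideal (fil_basis_set n) (fil_bracket n)"

abbreviation fil_words :: "nat \<Rightarrow> (fil_basis fmon \<Rightarrow>\<^sub>0 'a::field) set" where
  "fil_words n \<equiv> words_in (fil_basis_set n)"

lemma fil_generators_in:
  "{deg1 u * deg1 v - deg1 v * deg1 u - deg1 (fil_bracket n u v) | u v.
     Poly_Mapping.keys u \<subseteq> fil_basis_set n \<and> Poly_Mapping.keys v \<subseteq> fil_basis_set n} \<subseteq> fil_words n"
  by (auto intro!: words_in_diff words_in_mult deg1_in keys_fil_bracket)

lemma ideal_fil: "ideal (fil_ideal n) (free_algebra (fil_basis_set n))"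
  unfolding uea_ideal_def
  by (rule ring.genideal_ideal[OF ring_free_algebra, unfolded carrier_free_algebra, OF fil_generators_in])

lemma fil_ideal_closed:
  shows fil_ideal_add: "s \<in> fil_ideal n \<Longrightarrow> t \<in> fil_ideal n \<Longrightarrow> s + t \<in> fil_ideal n"
    and fil_ideal_0: "0 \<in> fil_ideal n"
    and fil_ideal_mult_left: "t \<in> fil_ideal n \<Longrightarrow> s \<in> fil_words n \<Longrightarrow> s * t \<in> fil_ideal n"
    and fil_ideal_mult_right: "t \<in> fil_ideal n \<Longrightarrow> s \<in> fil_words n \<Longrightarrow> t * s \<in> fil_ideal n"
    and fil_ideal_uminus: "t \<in> fil_ideal n \<Longrightarrow> - t \<in> fil_ideal n"
proof -
  interpret ideal "fil_ideal n" "free_algebra (fil_basis_set n)" by (rule ideal_fil)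
  have w: "t \<in> fil_ideal n \<Longrightarrow> t \<in> fil_words n"
    using a_subset unfolding carrier_free_algebra by blast
  show "s \<in> fil_ideal n \<Longrightarrow> t \<in> fil_ideal n \<Longrightarrow> s + t \<in> fil_ideal n"
    using additive_subgroup.a_closed[OF is_additive_subgroup] by simp
  show "0 \<in> fil_ideal n"
    using additive_subgroup.zero_closed[OF is_additive_subgroup] by simp
  show "t \<in> fil_ideal n \<Longrightarrow> s \<in> fil_words n \<Longrightarrow> s * t \<in> fil_ideal n"
    "t \<in> fil_ideal n \<Longrightarrow> s \<in> fil_words n \<Longrightarrow> t * s \<in> fil_ideal n"
    using I_l_closed I_r_closed unfolding carrier_free_algebra by simp_all
  show "t \<in> fil_ideal n \<Longrightarrow> - t \<in> fil_ideal n"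
    using additive_subgroup.a_inv_closed[OF is_additive_subgroup, of t] w by (simp add: a_inv_free_algebra)
qed

text \<open>Congruence modulo the ideal is written as membership of a difference; its transitivity
  chains the straightening steps below.\<close>

lemma fil_ideal_trans: "s - t \<in> fil_ideal n \<Longrightarrow> t - u \<in> fil_ideal n \<Longrightarrow> s - u \<in> fil_ideal n"
  using fil_ideal_add[of "s - t" n "t - u"] by simp

definition letter :: "'b \<Rightarrow> 'b fmon \<Rightarrow>\<^sub>0 'a::field" where
  "letter b = Poly_Mapping.single (FMon [b]) 1"

lemma letter_in [simp]: "b \<in> B \<Longrightarrow> letter b \<in> words_in B"
  by (simp add: letter_def words_in_single)

lemma fil_ideal_commutator:
  fixes u v :: "fil_basis \<Rightarrow>\<^sub>0 'a::field"
  assumes "Poly_Mapping.keys u \<subseteq> fil_basis_set n" "Poly_Mapping.keys v \<subseteq> fil_basis_set n"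
  shows "deg1 u * deg1 v - deg1 v * deg1 u - deg1 (fil_bracket n u v) \<in> fil_ideal n"
  unfolding uea_ideal_def
  by (rule subsetD[OF ring.genideal_self[OF ring_free_algebra, unfolded carrier_free_algebra, OF fil_generators_in]])
    (use assms in blast)

lemma fil_ideal_y_y:
  assumes "i \<le> n" "j \<le> n"
  shows "letter (By i) * letter (By j) - letter (By j) * letter (By i) \<in> (fil_ideal n :: (_ \<Rightarrow>\<^sub>0 'a::field) set)"
  using fil_ideal_commutator[of "Poly_Mapping.single (By i) (1::'a)" n "Poly_Mapping.single (By j) 1"] assms
  by (simp add: fil_bracket_basis deg1_single letter_def fil_basis_set_def) (simp add: deg1_def)

lemma fil_ideal_x_y:
  assumes "i \<le> n"
  shows "letter Bx * letter (By i) - letter (By i) * letter Bx - (if i = 0 then 0 else letter (By (i - 1)))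
     \<in> (fil_ideal n :: (_ \<Rightarrow>\<^sub>0 'a::field) set)"
proof -
  have [simp]: "deg1 0 = (0 :: _ \<Rightarrow>\<^sub>0 'a)" by (simp add: deg1_def)
  show ?thesis
    using fil_ideal_commutator[of "Poly_Mapping.single Bx (1::'a)" n "Poly_Mapping.single (By i) 1"] assms
    by (cases "i = 0") (simp_all add: fil_bracket_basis deg1_single letter_def fil_basis_set_def)
qed

section \<open>The representation on polynomials\<close>

primrec act_letter :: "nat \<Rightarrow> fil_basis \<Rightarrow> 'a::field mpol \<Rightarrow> 'a mpol" where
  "act_letter n Bx f = xder n f + yv (Suc n) * f"
| "act_letter n (By i) f = yv i * f"

text \<open>The variable \<open>T\<close> recording the powers of \<open>x\<close> is \<open>yv (Suc n)\<close>, which \<^term>\<open>xder n\<close> annihilates.\<close>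

definition act :: "nat \<Rightarrow> (fil_basis fmon \<Rightarrow>\<^sub>0 'a::field) \<Rightarrow> 'a mpol \<Rightarrow> 'a mpol" where
  "act n t f = (\<Sum>w\<in>Poly_Mapping.keys t. cst (Poly_Mapping.lookup t w) * foldr (act_letter n) (letters w) f)"

lemma act_letter_add: "act_letter n b (f + g) = act_letter n b f + act_letter n b g"
  by (cases b) (simp_all add: derivationD[OF derivation_xder] algebra_simps)

lemma act_letter_cst: "act_letter n b (cst c * f) = cst c * act_letter n b f"
  by (cases b) (simp_all add: derivationD[OF derivation_xder] algebra_simps)

lemma foldr_act_add:
  "foldr (act_letter n) l (f + g) = foldr (act_letter n) l f + foldr (act_letter n) l g"
  by (induction l) (simp_all add: act_letter_add)

lemma foldr_act_cst: "foldr (act_letter n) l (cst c * f) = cst c * foldr (act_letter n) l f"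
  by (induction l) (simp_all add: act_letter_cst)

lemma act_add: "act n (s + t) f = act n s f + act n t f"
  unfolding act_def by (rule setsum_keys_plus_distrib) (simp_all add: distrib_right)

lemma act_0 [simp]: "act n 0 f = 0"
  by (simp add: act_def)

lemma act_uminus: "act n (- t) f = - act n t f"
  using act_add[of n t "- t" f] by (simp add: eq_neg_iff_add_eq_0 add.commute)

lemma act_diff: "act n (s - t) f = act n s f - act n t f"
  using act_add[of n s "- t" f] by (simp add: act_uminus)

lemma act_sum: "act n (sum t A) f = (\<Sum>i\<in>A. act n (t i) f)"
  by (induction A rule: infinite_finite_induct) (simp_all add: act_add)

lemma act_single: "act n (Poly_Mapping.single (FMon l) c) f = cst c * foldr (act_letter n) l f"
  by (simp add: act_def)

lemma act_add_right: "act n t (f + g) = act n t f + act n t g"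
  by (simp add: act_def foldr_act_add algebra_simps sum.distrib)

lemma act_cst_right: "act n t (cst c * f) = cst c * act n t f"
  by (simp add: act_def foldr_act_cst sum_distrib_left mult.left_commute)

lemma act_0_right [simp]: "act n t 0 = 0"
  using act_cst_right[of n t 0 0] by simp

text \<open>\<open>foldr\<close> lets the last letter act first, so concatenation of words becomes
  composition of operators and the polynomials form a left module.\<close>

lemma act_mult: "act n (s * t) f = act n s (act n t f)"
proof (induction s rule: poly_mapping_single_induct)
  case (single w c)
  show ?case
  proof (induction t rule: poly_mapping_single_induct)
    case (single w' c')
    then show ?case
      by (cases w; cases w') (simp add: mult_single plus_fmon_def act_single foldr_act_cst mult_ac)
  qed (simp_all add: act_add distrib_left act_add_right)
qed (simp_all add: act_add distrib_right)

lemma act_letter_eq [simp]: "act n (letter b) f = act_letter n b f"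
  by (simp add: letter_def act_single)

lemma act_1 [simp]: "act n 1 f = f"
  using act_single[of n "[]" 1 f] by (simp flip: zero_fmon_def)

text \<open>The y-component of a Lie algebra element, read as a linear form: by
  \<open>act_deg1\<close> the element acts as a multiple of the operator of x plus multiplication by
  this form.\<close>

definition lin_part :: "nat \<Rightarrow> (fil_basis \<Rightarrow>\<^sub>0 'a::field) \<Rightarrow> 'a mpol" where
  "lin_part n u = (\<Sum>i\<le>n. cst (Poly_Mapping.lookup u (By i)) * yv i)"

lemma act_deg1:
  assumes "Poly_Mapping.keys u \<subseteq> fil_basis_set n"
  shows "act n (deg1 u) f = cst (Poly_Mapping.lookup u Bx) * act_letter n Bx f + lin_part n u * f"
proof -
  have "act n (deg1 u) f
      = (\<Sum>b\<in>Poly_Mapping.keys u. cst (Poly_Mapping.lookup u b) * act_letter n b f)"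
    by (simp add: deg1_def act_sum act_single)
  also have "\<dots> = (\<Sum>b\<in>fil_basis_set n. cst (Poly_Mapping.lookup u b) * act_letter n b f)"
    using assms by (intro sum.mono_neutral_left) (auto simp: fil_basis_set_def in_keys_iff)
  also have "\<dots> = cst (Poly_Mapping.lookup u Bx) * act_letter n Bx f
      + (\<Sum>b\<in>By ` {..n}. cst (Poly_Mapping.lookup u b) * act_letter n b f)"
    unfolding fil_basis_set_def by (rule sum.insert) auto
  also have "(\<Sum>b\<in>By ` {..n}. cst (Poly_Mapping.lookup u b) * act_letter n b f) = lin_part n u * f"
    by (subst sum.reindex) (auto simp: inj_on_def lin_part_def sum_distrib_right mult.assoc)
  finally show ?thesis .
qed

lemma xder_lin_part:
  "xder n (lin_part n u) = (\<Sum>i<n. cst (Poly_Mapping.lookup u (By (Suc i))) * yv i)"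
proof -
  have "xder n (lin_part n u)
     = (\<Sum>i\<le>n. cst (Poly_Mapping.lookup u (By i)) * (if i = 0 then 0 else yv (i - 1)))"
    unfolding lin_part_def
    unfolding derivation_sum[OF derivation_xder]
    by (intro sum.cong refl) (simp add: derivationD[OF derivation_xder] xder_yv_if)
  then show ?thesis
    by (simp only: sum.atMost_shift) simp
qed

text \<open>On linear forms \<open>xder n\<close> is the adjoint action of x, and the y's commute,
  so only the two mixed terms of the bracket remain.\<close>

lemma lin_part_bracket:
  "lin_part n (fil_bracket n u v)
     = cst (Poly_Mapping.lookup u Bx) * xder n (lin_part n v) - cst (Poly_Mapping.lookup v Bx) * xder n (lin_part n u)"
proof -
  have "lin_part n (fil_bracket n u v) = (\<Sum>i<n. cst (Poly_Mapping.lookup u Bx * Poly_Mapping.lookup v (By (Suc i))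
        - Poly_Mapping.lookup u (By (Suc i)) * Poly_Mapping.lookup v Bx) * yv i)"
    unfolding lin_part_def
    by (rule sum.mono_neutral_cong_right) (auto simp: fil_bracket_lookup)
  then show ?thesis
    by (simp add: xder_lin_part sum_distrib_left algebra_simps sum_subtractf)
qed

text \<open>The elements acting as zero form a two-sided ideal. It contains the generators, since
  the commutator of the operator of x with multiplication by a linear form is multiplication by the
  image of that form under \<open>xder n\<close>; minimality of the generated ideal does the
  rest.\<close>

lemma act_fil_ideal:
  fixes t :: "fil_basis fmon \<Rightarrow>\<^sub>0 'a::field"
  assumes "t \<in> fil_ideal n"
  shows "act n t f = 0"
proof -
  let ?A = "{t \<in> fil_words n. \<forall>f. act n t f = (0 :: 'a mpol)}"
  have "ideal ?A (free_algebra (fil_basis_set n))"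
  proof (rule idealI[OF ring_free_algebra])
    show "subgroup ?A (add_monoid (free_algebra (fil_basis_set n)))"
    proof (rule group.subgroupI[OF abelian_group.a_group[OF ring.is_abelian_group[OF ring_free_algebra]]])
      fix t assume "t \<in> ?A"
      then show "inv\<^bsub>add_monoid (free_algebra (fil_basis_set n))\<^esub> t \<in> ?A"
        using a_inv_free_algebra[of t "fil_basis_set n"]
        by (simp add: a_inv_def words_in_uminus act_uminus)
    qed (auto simp: act_add words_in_add intro!: exI[of _ 0])
  qed (unfold carrier_free_algebra, auto simp: words_in_mult act_mult)
  moreover have "deg1 u * deg1 v - deg1 v * deg1 u - deg1 (fil_bracket n u v) \<in> ?A"
    if "Poly_Mapping.keys u \<subseteq> fil_basis_set n" "Poly_Mapping.keys v \<subseteq> fil_basis_set n" for u v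
  proof -
    have "act n (deg1 u * deg1 v - deg1 v * deg1 u - deg1 (fil_bracket n u v)) f = 0" for f
      unfolding act_diff act_mult act_deg1[OF that(1)] act_deg1[OF that(2)]
        act_deg1[OF keys_fil_bracket] lin_part_bracket fil_bracket_lookup
      by (simp add: derivationD[OF derivation_xder] algebra_simps)
    then show ?thesis
      using that by (auto intro!: words_in_diff words_in_mult deg1_in keys_fil_bracket)
  qed
  ultimately have "fil_ideal n \<subseteq> ?A"
    unfolding uea_ideal_def by (intro ring.genideal_minimal[OF ring_free_algebra]) auto
  then show ?thesis using assms by blast
qed

subsection \<open>Ordered words\<close>

definition y_word :: "nat list \<Rightarrow> (nat \<Rightarrow>\<^sub>0 nat) \<Rightarrow> fil_basis list" where
  "y_word l m = concat (map (\<lambda>i. replicate (Poly_Mapping.lookup m i) (By i)) l)"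

text \<open>The exponent at \<open>Suc n\<close> counts the letters x. They stand on the right and
  so act first, turning 1 into a power of T.\<close>

definition ordered_word :: "nat \<Rightarrow> (nat \<Rightarrow>\<^sub>0 nat) \<Rightarrow> fil_basis fmon" where
  "ordered_word n m = pbw_word n m + FMon (replicate (Poly_Mapping.lookup m (Suc n)) Bx)"

text \<open>The linear map from y^m T^k to the ordered word y^m x^k. Modulo the ideal it will be
  inverse to the action on 1.\<close>

definition lift :: "nat \<Rightarrow> 'a::field mpol \<Rightarrow> fil_basis fmon \<Rightarrow>\<^sub>0 'a" where
  "lift n p = (\<Sum>m\<in>Poly_Mapping.keys p. Poly_Mapping.single (ordered_word n m) (Poly_Mapping.lookup p m))"

lemma pbw_word_eq: "pbw_word n m = FMon (y_word [0..<Suc n] m)"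
  by (simp add: pbw_word_def y_word_def)

lemma pbw_eq:
  assumes "p \<in> ypolys n"
  shows "pbw n p = fil_ideal n +>\<^bsub>free_algebra (fil_basis_set n)\<^esub> lift n p"
proof -
  have "ordered_word n m = pbw_word n m" if "m \<in> Poly_Mapping.keys p" for m
  proof -
    have "Suc n \<notin> Poly_Mapping.keys m"
      using assms that by (force simp: ypolys_def)
    then show ?thesis
      by (simp add: ordered_word_def in_keys_iff flip: zero_fmon_def)
  qed
  then show ?thesis by (simp add: pbw_def lift_def cong: sum.cong)
qed

lemma lift_add: "lift n (p + q) = lift n p + lift n q"
  unfolding lift_def by (rule setsum_keys_plus_distrib) (simp_all add: single_add)

lemma lift_0 [simp]: "lift n 0 = 0"
  by (simp add: lift_def)

lemma lift_single: "lift n (Poly_Mapping.single m c) = Poly_Mapping.single (ordered_word n m) c"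
  by (simp add: lift_def)

lemma y_word_0 [simp]: "y_word l 0 = []"
  by (induction l) (simp_all add: y_word_def)

lemma lift_cst: "lift n (cst c) = Poly_Mapping.single 0 c"
  by (simp add: cst_def lift_single ordered_word_def pbw_word_eq flip: zero_fmon_def)

lemma lift_1 [simp]: "lift n 1 = 1"
  using lift_cst[of n 1] by simp

lemma set_y_word: "set (y_word l m) \<subseteq> By ` set l"
  by (auto simp: y_word_def)

lemma lift_in [simp]: "lift n p \<in> fil_words n"
  unfolding lift_def
proof (rule words_in_sum)
  fix m
  show "Poly_Mapping.single (ordered_word n m) (Poly_Mapping.lookup p m) \<in> fil_words n"
    using set_y_word[of "[0..<Suc n]" m]
    by (auto simp: ordered_word_def pbw_word_eq plus_fmon_def fil_basis_set_def intro!: words_in_single)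
qed

text \<open>Since x comes last in an ordered word, one more power of T is one more x on the right;
  this holds already in the free algebra, before passing to the quotient.\<close>

lemma lift_mult_T: "lift n (yv (Suc n) * p) = lift n p * letter Bx"
proof (induction p rule: poly_mapping_single_induct)
  case (single m c)
  have "y_word [0..<Suc n] (Poly_Mapping.single (Suc n) 1 + m) = y_word [0..<Suc n] m"
    unfolding y_word_def by (intro arg_cong[where f = concat] map_cong refl) (auto simp: lookup_add lookup_single when_def)
  then show ?case
    by (simp add: yv_def mult_single lift_single letter_def ordered_word_def pbw_word_eq plus_fmon_def
      lookup_add replicate_append_same del: upt_Suc)
qed (simp_all add: distrib_left distrib_right lift_add)

lemma y_commutes_mod:
  assumes "i \<le> n" "set l \<subseteq> By ` {..n}"
  shows "letter (By i) * Poly_Mapping.single (FMon l) 1 - Poly_Mapping.single (FMon l) 1 * letter (By i)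
     \<in> (fil_ideal n :: (_ \<Rightarrow>\<^sub>0 'a::field) set)"
  using assms(2)
proof (induction l)
  case Nil
  then show ?case by (simp add: fil_ideal_0 flip: zero_fmon_def)
next
  case (Cons b l)
  then obtain j where j: "b = By j" "j \<le> n" by auto
  let ?w = "Poly_Mapping.single (FMon l) (1::'a)" and ?e = "\<lambda>i. letter (By i) :: _ \<Rightarrow>\<^sub>0 'a"
  have eq: "Poly_Mapping.single (FMon (b # l)) 1 = ?e j * ?w"
    by (simp add: letter_def mult_single plus_fmon_def j)
  have in_w: "?w \<in> fil_words n" "?e j \<in> fil_words n"
    using Cons.prems j by (auto simp: fil_basis_set_def intro!: words_in_single)
  have "(?e i * ?e j - ?e j * ?e i) * ?w + ?e j * (?e i * ?w - ?w * ?e i) \<in> fil_ideal n"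
    using Cons j assms in_w
    by (intro fil_ideal_add fil_ideal_mult_right fil_ideal_mult_left fil_ideal_y_y) auto
  then show ?case unfolding eq by (simp add: algebra_simps)
qed

lemma y_times_ordered_word:
  assumes "i \<le> n"
  shows "letter (By i) * Poly_Mapping.single (ordered_word n m) 1
      - Poly_Mapping.single (ordered_word n (Poly_Mapping.single i 1 + m)) 1 \<in> (fil_ideal n :: (_ \<Rightarrow>\<^sub>0 'a::field) set)"
proof -
  \<comment> \<open>The new letter has to cross only \<open>pre\<close>, the letters with index
    below \<open>i\<close>; \<open>post\<close> begins exactly where \<open>By i\<close>
    belongs.\<close>
  define pre post where "pre = y_word [0..<i] m"
    and "post = y_word (i # [Suc i..<Suc n]) m @ replicate (Poly_Mapping.lookup m (Suc n)) Bx"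
  have upt: "[0..<Suc n] = [0..<i] @ i # [Suc i..<Suc n]"
    using assms by (metis upt_add_eq_append upt_conv_Cons le0 le_imp_less_Suc less_eqE less_imp_le_nat add_Suc_right)
  have y_word_app: "y_word (k @ l) m' = y_word k m' @ y_word l m'" for k l m'
    by (simp add: y_word_def)
  have other: "y_word l (Poly_Mapping.single i 1 + m) = y_word l m" if "i \<notin> set l" for l
    unfolding y_word_def using that
    by (intro arg_cong[where f = concat] map_cong refl) (auto simp: lookup_add lookup_single when_def)
  have w: "ordered_word n m = FMon pre + FMon post"
    unfolding ordered_word_def pbw_word_eq upt y_word_app pre_def post_def by (simp add: plus_fmon_def)
  have "y_word (i # [Suc i..<Suc n]) (Poly_Mapping.single i 1 + m) = By i # y_word (i # [Suc i..<Suc n]) m"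
    using other[of "[Suc i..<Suc n]"] by (simp add: y_word_def lookup_add del: upt_Suc)
  then have w': "ordered_word n (Poly_Mapping.single i 1 + m) = FMon pre + FMon [By i] + FMon post"
    using assms other[of "[0..<i]"] unfolding ordered_word_def pbw_word_eq upt y_word_app pre_def post_def
    by (simp add: plus_fmon_def other lookup_add lookup_single del: upt_Suc)
  let ?p = "Poly_Mapping.single (FMon pre) (1::'a)" and ?q = "Poly_Mapping.single (FMon post) (1::'a)"
  have "?q \<in> fil_words n"
    using set_y_word[of "i # [Suc i..<Suc n]" m] assms
    by (intro words_in_single) (auto simp: post_def fil_basis_set_def)
  moreover have "set pre \<subseteq> By ` {..n}"
    using set_y_word[of "[0..<i]" m] assms by (auto simp: pre_def)
  ultimately have "(letter (By i) * ?p - ?p * letter (By i)) * ?q \<in> fil_ideal n"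
    using assms by (intro fil_ideal_mult_right y_commutes_mod) auto
  then show ?thesis
    unfolding w w' letter_def by (simp add: mult_single left_diff_distrib add.assoc)
qed

lemma fil_ideal_scalar:
  assumes "t \<in> fil_ideal n"
  shows "Poly_Mapping.single 0 c * t \<in> fil_ideal n"
  by (rule fil_ideal_mult_left[OF assms]) (simp add: zero_fmon_def words_in_single)

lemma y_times_lift:
  assumes "i \<le> n"
  shows "letter (By i) * lift n p - lift n (yv i * p) \<in> fil_ideal n"
proof (induction p rule: poly_mapping_single_induct)
  case (single m c)
  show ?case
    using fil_ideal_scalar[OF y_times_ordered_word[OF assms, of m], of c]
    by (simp add: lift_single yv_def mult_single letter_def right_diff_distrib)
next
  case (add p q)
  show ?case using fil_ideal_add[OF add]
    by (simp add: lift_add distrib_left algebra_simps)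
qed (simp add: fil_ideal_0)

text \<open>Straightening of x past an ordered word. Modulo the ideal, x y_i equals y_i x + y_(i-1),
  which mirrors the product rule for \<open>xder n\<close>; a factor T is carried along unchanged as
  an x on the right.\<close>

lemma x_times_lift:
  assumes "p \<in> polys_in {..Suc n}"
  shows "letter Bx * lift n p - lift n (act_letter n Bx p) \<in> fil_ideal n"
  using assms
proof (induction p rule: polys_in_induct)
  case (cst c)
  have "letter Bx * lift n (cst c) - lift n (act_letter n Bx (cst c)) = 0"
    by (simp add: derivationD[OF derivation_xder] lift_mult_T lift_cst letter_def mult_single)
  then show ?case by (simp add: fil_ideal_0)
next
  case (add p q)
  then show ?case using fil_ideal_add[OF add(3,4)]
    by (simp add: lift_add distrib_left derivationD[OF derivation_xder] algebra_simps)
next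
  case (yv i p)
  let ?x = "letter Bx :: _ \<Rightarrow>\<^sub>0 'a" and ?y = "letter (By i) :: _ \<Rightarrow>\<^sub>0 'a"
    and ?z = "if i = 0 then 0 else letter (By (i - 1)) :: _ \<Rightarrow>\<^sub>0 'a"
  have Bx: "?x \<in> fil_words n" by (simp add: fil_basis_set_def)
  show ?case
  proof (cases "i \<le> n")
    case True
    have By: "?y \<in> fil_words n" using True by (simp add: fil_basis_set_def)
    have 1: "?x * lift n (yv i * p) - ?x * (?y * lift n p) \<in> fil_ideal n"
      using fil_ideal_mult_left[OF fil_ideal_uminus[OF y_times_lift[OF True, of p]] Bx]
      by (simp add: algebra_simps)
    have 2: "?x * (?y * lift n p) - (?y * ?x * lift n p + ?z * lift n p) \<in> fil_ideal n"
      using fil_ideal_mult_right[OF fil_ideal_x_y[OF True] lift_in, of p]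
      by (simp only: left_diff_distrib distrib_right mult.assoc diff_diff_eq)
    have 3: "?y * ?x * lift n p - ?y * lift n (act_letter n Bx p) \<in> fil_ideal n"
      using fil_ideal_mult_left[OF yv(3) By] by (simp add: algebra_simps)
    have 4: "?y * lift n (act_letter n Bx p) - lift n (yv i * act_letter n Bx p) \<in> fil_ideal n"
      by (rule y_times_lift[OF True])
    \<comment> \<open>The term from the bracket of x and y_i; for \<open>i = 0\<close> both parts
      are zero.\<close>
    have 5: "?z * lift n p - lift n (xder n (yv i) * p) \<in> fil_ideal n"
      using y_times_lift[of "i - 1" n p] True by (simp add: xder_yv_if fil_ideal_0)
    have "(?y * ?x * lift n p + ?z * lift n p) - (lift n (yv i * act_letter n Bx p) + lift n (xder n (yv i) * p))
       \<in> fil_ideal n"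
      using fil_ideal_add[OF fil_ideal_trans[OF 3 4] 5] by (simp add: algebra_simps)
    moreover have "lift n (yv i * act_letter n Bx p) + lift n (xder n (yv i) * p) = lift n (act_letter n Bx (yv i * p))"
      by (simp add: derivationD[OF derivation_xder] algebra_simps flip: lift_add)
    ultimately show ?thesis
      using fil_ideal_trans[OF fil_ideal_trans[OF 1 2]] by simp
  next
    case False
    then have i: "i = Suc n" using yv by auto
    have "act_letter n Bx (yv i * p) = yv (Suc n) * act_letter n Bx p"
      by (simp add: i derivationD[OF derivation_xder] xder_yv_if algebra_simps)
    then have "?x * lift n (yv i * p) - lift n (act_letter n Bx (yv i * p))
        = (?x * lift n p - lift n (act_letter n Bx p)) * ?x"
      by (simp only: i lift_mult_T left_diff_distrib mult.assoc)
    then show ?thesis using fil_ideal_mult_right[OF yv(3) Bx] by simp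
  qed
qed

lemma act_letter_closed:
  assumes "b \<in> fil_basis_set n" "p \<in> polys_in {..Suc n}"
  shows "act_letter n b p \<in> polys_in {..Suc n}"
  using assms by (auto simp: fil_basis_set_def intro!: polys_in_intros xder_closed)

lemma letter_times_lift:
  "b \<in> fil_basis_set n \<Longrightarrow> p \<in> polys_in {..Suc n} \<Longrightarrow>
    letter b * lift n p - lift n (act_letter n b p) \<in> fil_ideal n"
  using x_times_lift y_times_lift by (fastforce simp: fil_basis_set_def)

lemma words_in_induct [consumes 1, case_names zero scalar letter add]:
  fixes t :: "'b fmon \<Rightarrow>\<^sub>0 'a::field"
  assumes "t \<in> words_in B" and "P 0" and "\<And>c. P (Poly_Mapping.single 0 c)"
    and letter: "\<And>b t. b \<in> B \<Longrightarrow> t \<in> words_in B \<Longrightarrow> P t \<Longrightarrow> P (letter b * t)"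
    and "\<And>s t. s \<in> words_in B \<Longrightarrow> t \<in> words_in B \<Longrightarrow> P s \<Longrightarrow> P t \<Longrightarrow> P (s + t)"
  shows "P t"
proof -
  have "Poly_Mapping.keys t \<subseteq> {w. set (letters w) \<subseteq> B}"
    using assms(1) by (auto simp: words_in_def)
  then show ?thesis
  proof (induction t rule: poly_mapping_keys_induct)
    case (single w c)
    have "P (Poly_Mapping.single (FMon l) c)" if "set l \<subseteq> B" for l
      using that
    proof (induction l)
      case Nil
      then show ?case using assms(3) by (simp add: zero_fmon_def)
    next
      case (Cons b l)
      then have "P (letter b * Poly_Mapping.single (FMon l) c)"
        by (intro letter words_in_single) auto
      then show ?case by (simp add: letter_def mult_single plus_fmon_def)
    qed
    then show ?case using single by (cases w) auto
  next
    case (add s t)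
    then show ?case by (intro assms(5)) (auto simp: words_in_def)
  qed (rule assms)
qed

lemma single_0_act: "act n (Poly_Mapping.single 0 c) f = cst c * f"
  by (simp add: zero_fmon_def act_single)

lemma act_closed:
  assumes "t \<in> fil_words n" "p \<in> polys_in {..Suc n}"
  shows "act n t p \<in> polys_in {..Suc n}"
  using assms(1) by (induction t rule: words_in_induct)
    (use assms(2) in \<open>auto simp: act_add single_0_act act_mult act_letter_closed intro!: polys_in_intros\<close>)

lemma single_0_times_lift: "Poly_Mapping.single 0 c * lift n p = lift n (cst c * p)"
  by (induction p rule: poly_mapping_single_induct)
    (simp_all add: lift_add distrib_left cst_def mult_single lift_single)

text \<open>Modulo the ideal \<open>lift n\<close> is a module homomorphism: the one-letter case is
  iterated over the letters of \<open>t\<close>. Taking \<open>p = 1\<close> shows that ordered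
  words span the enveloping algebra.\<close>

lemma words_times_lift:
  assumes "t \<in> fil_words n" "p \<in> polys_in {..Suc n}"
  shows "t * lift n p - lift n (act n t p) \<in> fil_ideal n"
  using assms(1)
proof (induction t rule: words_in_induct)
  case (letter b t)
  have "letter b * (t * lift n p - lift n (act n t p)) \<in> fil_ideal n"
    using letter by (intro fil_ideal_mult_left) simp_all
  then have "letter b * t * lift n p - letter b * lift n (act n t p) \<in> fil_ideal n"
    by (simp add: algebra_simps)
  moreover have "letter b * lift n (act n t p) - lift n (act_letter n b (act n t p)) \<in> fil_ideal n"
    using letter assms by (intro letter_times_lift act_closed)
  ultimately show ?case
    using fil_ideal_trans by (simp add: act_mult)
next
  case (add s t)
  then show ?case using fil_ideal_add[OF add(3,4)] by (simp add: distrib_right act_add lift_add algebra_simps)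
qed (simp_all add: fil_ideal_0 single_0_act single_0_times_lift)

lemma lift_act_1:
  assumes "t \<in> fil_words n"
  shows "t - lift n (act n t 1) \<in> fil_ideal n"
  using words_times_lift[OF assms, of 1] by simp

text \<open>The form of Poincare-Birkhoff-Witt used from here on: spanning by ordered words makes
  the ideal exactly the annihilator of 1, so membership becomes a computation with
  polynomials.\<close>

lemma fil_ideal_iff:
  assumes "t \<in> fil_words n"
  shows "t \<in> fil_ideal n \<longleftrightarrow> act n t 1 = 0"
  using lift_act_1[OF assms] act_fil_ideal[of t n 1] by auto

lemma act_lift_y: "i \<le> n \<Longrightarrow> act n (lift n (yv i * p)) f = yv i * act n (lift n p) f"
  using act_fil_ideal[OF y_times_lift, of i n p f] by (simp add: act_diff act_mult)

lemma act_lift_T: "act n (lift n (yv (Suc n) * p)) f = act n (lift n p) (act_letter n Bx f)"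
  by (simp add: lift_mult_T act_mult)

lemma act_lift_ypolys:
  assumes "p \<in> polys_in {..n}"
  shows "act n (lift n p) f = p * f"
  using assms by (induction p rule: polys_in_induct)
    (simp_all add: act_lift_y lift_cst single_0_act lift_add act_add distrib_right mult.assoc)

text \<open>On an invariant the operator of x reduces to multiplication by T, and T times an
  invariant is again an invariant; hence the induction over all \<open>f\<close>.\<close>

lemma act_lift_invariant:
  assumes "p \<in> polys_in {..Suc n}" and "xder n f = 0"
  shows "act n (lift n p) f = p * f"
  using assms
proof (induction p arbitrary: f rule: polys_in_induct)
  case (yv i p)
  show ?case
  proof (cases "i \<le> n")
    case False
    then have "i = Suc n" using yv by auto
    moreover have "xder n (yv (Suc n) * f) = 0"
      using yv by (simp add: derivationD[OF derivation_xder] xder_yv_if)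
    ultimately show ?thesis using yv by (simp add: act_lift_T mult.assoc mult.left_commute)
  qed (use yv in \<open>simp add: act_lift_y mult.assoc\<close>)
qed (simp_all add: lift_cst single_0_act lift_add act_add distrib_right)

text \<open>Applying x + T to y_1 f gives T y_1 f + y_0 f, and y_0 f is invariant. Repeating this k
  times produces T^k y_1 f + k T^(k-1) y_0 f, whose second coefficient is the derivative in
  T.\<close>

lemma act_lift_y1:
  assumes "p \<in> polys_in {..Suc n}" and "n \<ge> 1" and "xder n f = 0"
  shows "act n (lift n p) (yv 1 * f) = p * yv 1 * f + pdiff (Suc n) p * yv 0 * f"
  using assms(1,3)
proof (induction p arbitrary: f rule: polys_in_induct)
  case (cst c)
  then show ?case by (simp add: lift_cst single_0_act derivationD[OF derivation_pdiff])
next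
  case (add p q)
  then show ?case
    by (simp add: lift_add act_add distrib_right derivationD[OF derivation_pdiff])
next
  case (yv i p)
  show ?case
  proof (cases "i \<le> n")
    case False
    then have i: "i = Suc n" using yv by auto
    \<comment> \<open>Both T f and y_0 f are invariant again: the induction hypothesis applies to
      the first, \<open>act_lift_invariant\<close> to the second.\<close>
    have 1: "xder n (yv (Suc n) * f) = 0" "xder n (yv 0 * f) = 0"
      using yv by (simp_all add: derivationD[OF derivation_xder] xder_yv_if)
    have "act_letter n Bx (yv 1 * f) = yv 0 * f + yv 1 * (yv (Suc n) * f)"
      using yv assms by (simp add: derivationD[OF derivation_xder] xder_yv_if mult_ac)
    then have "act n (lift n (yv i * p)) (yv 1 * f)
       = act n (lift n p) (yv 0 * f) + act n (lift n p) (yv 1 * (yv (Suc n) * f))"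
      by (simp only: i act_lift_T act_add_right)
    also have "\<dots> = p * (yv 0 * f) + (p * yv 1 * (yv (Suc n) * f) + pdiff (Suc n) p * yv 0 * (yv (Suc n) * f))"
      using yv(3)[OF 1(1)] act_lift_invariant[OF yv(2) 1(2)] by simp
    finally show ?thesis
      by (simp add: i derivationD[OF derivation_pdiff] pdiff_yv algebra_simps)
  qed (use yv in \<open>simp add: act_lift_y derivationD[OF derivation_pdiff] pdiff_yv distrib_left mult.assoc\<close>)
qed

subsection \<open>The center\<close>

abbreviation fil_coset :: "nat \<Rightarrow> (fil_basis fmon \<Rightarrow>\<^sub>0 'a::field) \<Rightarrow> (fil_basis fmon \<Rightarrow>\<^sub>0 'a) set" where
  "fil_coset n t \<equiv> fil_ideal n +>\<^bsub>free_algebra (fil_basis_set n)\<^esub> t"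

lemma fil_coset_ring_hom: "fil_coset n \<in> ring_hom (free_algebra (fil_basis_set n)) (fil_uea n)"
  unfolding fil_uea_def uea_def by (rule ideal.rcos_ring_hom[OF ideal_fil])

lemma carrier_fil_uea: "carrier (fil_uea n) = fil_coset n ` fil_words n"
  unfolding fil_uea_def uea_def FactRing_def carrier_free_algebra[symmetric]
  by (auto simp: A_RCOSETS_def' simp del: free_algebra_simps)

lemma fil_coset_eq_iff:
  assumes "s \<in> fil_words n" "t \<in> fil_words n"
  shows "fil_coset n s = fil_coset n t \<longleftrightarrow> act n s 1 = act n t 1"
proof -
  have "fil_coset n s = fil_coset n t \<longleftrightarrow> s \<ominus>\<^bsub>free_algebra (fil_basis_set n)\<^esub> t \<in> fil_ideal n"
    using ring.quotient_eq_iff_same_a_r_cos[OF ring_free_algebra ideal_fil] assms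
    unfolding carrier_free_algebra by blast
  then show ?thesis
    using assms by (simp add: a_minus_def a_inv_free_algebra fil_ideal_iff words_in_diff act_diff)
qed

text \<open>The action on 1 separates cosets, so two elements commute in the quotient as soon as
  their two products agree on 1.\<close>

lemma fil_coset_central_iff:
  assumes "t \<in> fil_words n"
  shows "fil_coset n t \<in> ring_center (fil_uea n)
    \<longleftrightarrow> (\<forall>s\<in>fil_words n. act n t (act n s 1) = act n s (act n t 1))"
proof -
  have "fil_coset n t \<otimes>\<^bsub>fil_uea n\<^esub> fil_coset n s = fil_coset n s \<otimes>\<^bsub>fil_uea n\<^esub> fil_coset n t
     \<longleftrightarrow> act n t (act n s 1) = act n s (act n t 1)" if "s \<in> fil_words n" for s
    using ring_hom_mult[OF fil_coset_ring_hom, unfolded carrier_free_algebra, OF that assms, symmetric]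
      ring_hom_mult[OF fil_coset_ring_hom, unfolded carrier_free_algebra, OF assms that, symmetric]
    using that assms by (simp add: fil_coset_eq_iff words_in_mult flip: act_mult)
  then show ?thesis
    using assms by (simp add: ring_center_def carrier_fil_uea)
qed

lemma act_invariant:
  assumes "xder n f = 0" and "t \<in> fil_words n"
  shows "act n t (f * g) = f * act n t g"
proof -
  have "act_letter n b (f * g) = f * act_letter n b g" for b g
    using assms(1) by (cases b) (simp_all add: derivationD[OF derivation_xder] algebra_simps)
  note inv = this
  show ?thesis
    using assms(2) by (induction t arbitrary: g rule: words_in_induct)
      (simp_all add: inv act_add distrib_left single_0_act act_mult mult_ac)
qed

text \<open>The lift of f acts as multiplication by f. Commuting with x, tested on 1, compares f T
  with x(f) + T f; conversely, multiplication by an invariant commutes with every operator of the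
  representation.\<close>

theorem Zn_eq: "Zn n = {f \<in> polys_in {..n}. xder n f = 0}"
proof -
  have "pbw n f \<in> ring_center (fil_uea n) \<longleftrightarrow> xder n f = 0" if f: "f \<in> polys_in {..n}" for f :: "'a mpol"
  proof
    assume "pbw n f \<in> ring_center (fil_uea n)"
    then have "act n (lift n f) (act n (letter Bx) 1) = act n (letter Bx) (act n (lift n f) 1)"
      using f pbw_eq fil_coset_central_iff[OF lift_in]
      by (metis ypolys_eq letter_in fil_basis_set_def insertI1)
    then show "xder n f = 0"
      using f by (simp add: act_lift_ypolys derivationD[OF derivation_xder])
  next
    assume "xder n f = 0"
    then show "pbw n f \<in> ring_center (fil_uea n)"
      using f act_invariant[of n f _ 1]
      by (simp add: pbw_eq ypolys_eq fil_coset_central_iff act_lift_ypolys)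
  qed
  then show ?thesis by (auto simp: Zn_def ypolys_eq)
qed

theorem pbw_ring_hom: "(pbw n :: 'a::field mpol \<Rightarrow> _) \<in> ring_hom (ring_of_type_algebra\<lparr>carrier := ypolys n\<rparr>) (fil_uea n)"
proof -
  have cl: "p + q \<in> ypolys n" "p * q \<in> ypolys n" if "p \<in> ypolys n" "q \<in> ypolys n" for p q :: "'a mpol"
    using that by (auto simp: ypolys_eq intro: polys_in_intros)
  note hom = fil_coset_ring_hom[of n, where 'a = 'a]
  have [simp]: "(1 :: 'a mpol) \<in> ypolys n" by (simp add: ypolys_eq)
  show ?thesis
  proof (rule ring_hom_memI; simp add: ring_of_type_algebra_def)
    fix p :: "'a mpol" assume p: "p \<in> ypolys n"
    then show "pbw n p \<in> carrier (fil_uea n)" by (simp add: pbw_eq carrier_fil_uea)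
    fix q :: "'a mpol" assume q: "q \<in> ypolys n"
    have "fil_coset n (lift n (p * q)) = fil_coset n (lift n p * lift n q)"
      using p q cl[OF p q] by (subst fil_coset_eq_iff) (simp_all add: words_in_mult act_mult act_lift_ypolys ypolys_eq)
    then show "pbw n (p * q) = pbw n p \<otimes>\<^bsub>fil_uea n\<^esub> pbw n q"
      using p q cl[OF p q] ring_hom_mult[OF hom, unfolded carrier_free_algebra, OF lift_in lift_in]
      by (simp add: pbw_eq)
    show "pbw n (p + q) = pbw n p \<oplus>\<^bsub>fil_uea n\<^esub> pbw n q"
      using p q cl[OF p q] ring_hom_add[OF hom, unfolded carrier_free_algebra, OF lift_in lift_in]
      by (simp add: pbw_eq lift_add)
  next
    show "pbw n (1 :: 'a mpol) = \<one>\<^bsub>fil_uea n\<^esub>"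
      using ring_hom_one[OF hom] by (subst pbw_eq) simp_all
  qed
qed

text \<open>A polynomial is recovered from its coset as the image of 1 under the action.\<close>

theorem pbw_inj: "inj_on (pbw n) (ypolys n)"
  by (rule inj_onI) (auto simp: pbw_eq fil_coset_eq_iff act_lift_ypolys ypolys_eq)

text \<open>For surjectivity let q be the image of 1 under a central element. Commutation with y_1,
  tested on 1, gives y_0 times the derivative of q in T equal to zero. In characteristic zero q is
  then free of T, and \<open>pbw n q\<close> is the given coset.\<close>

theorem pbw_Zn:
  assumes "n \<ge> 1"
  shows "pbw n ` (Zn n :: 'a::field_char_0 mpol set) = ring_center (fil_uea n)"
proof
  show "pbw n ` (Zn n :: 'a mpol set) \<subseteq> ring_center (fil_uea n)"
    by (auto simp: Zn_def)
  show "ring_center (fil_uea n) \<subseteq> pbw n ` (Zn n :: 'a mpol set)"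
  proof
    fix c :: "(fil_basis fmon \<Rightarrow>\<^sub>0 'a) set"
    assume c: "c \<in> ring_center (fil_uea n)"
    then obtain t where t: "t \<in> fil_words n" "c = fil_coset n t"
      by (auto simp: ring_center_def carrier_fil_uea)
    define q where "q = act n t 1"
    have q: "q \<in> polys_in {..Suc n}"
      unfolding q_def using t by (intro act_closed) auto
    have "letter (By 1) \<in> fil_words n"
      using assms by (simp add: fil_basis_set_def)
    then have 1: "act n t (act n (letter (By 1)) 1) = act n (letter (By 1)) q"
      using c t fil_coset_central_iff unfolding q_def by blast
    have "act n t (yv 1) = act n (lift n q) (yv 1)"
      using act_fil_ideal[OF lift_act_1[OF t(1)], of "yv 1"] by (simp add: act_diff q_def)
    also have "\<dots> = q * yv 1 + pdiff (Suc n) q * yv 0"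
      using act_lift_y1[OF q assms, of 1] by (simp add: derivationD[OF derivation_xder])
    finally have "pdiff (Suc n) q = 0"
      using 1 by (simp add: mult.commute)
    then have qn: "q \<in> ypolys n"
      using q pdiff_eq_0_iff[of q "Suc n" "{..n}"] by (simp add: ypolys_eq atMost_Suc)
    have "pbw n q = c"
      using qn t by (simp add: pbw_eq fil_coset_eq_iff act_lift_ypolys ypolys_eq) (simp add: q_def)
    moreover have "q \<in> Zn n" using c qn \<open>pbw n q = c\<close> by (simp add: Zn_def)
    ultimately show "c \<in> pbw n ` Zn n" by blast
  qed
qed

section \<open>Invariants of the derivation\<close>

lemmas xder_simps = derivationD[OF derivation_xder] derivation_power[OF derivation_xder]
  derivation_sum[OF derivation_xder]

lemma Zn_cst [simp]: "cst c \<in> Zn n"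
  and Zn_1 [simp]: "1 \<in> Zn n"
  and Zn_0 [simp]: "0 \<in> Zn n"
  and Zn_add: "p \<in> Zn n \<Longrightarrow> q \<in> Zn n \<Longrightarrow> p + q \<in> Zn n"
  and Zn_mult: "p \<in> Zn n \<Longrightarrow> q \<in> Zn n \<Longrightarrow> p * q \<in> Zn n"
  and Zn_uminus: "p \<in> Zn n \<Longrightarrow> - p \<in> Zn n"
  and Zn_diff: "p \<in> Zn n \<Longrightarrow> q \<in> Zn n \<Longrightarrow> p - q \<in> Zn n"
  by (auto simp: Zn_eq xder_simps intro: polys_in_intros)

lemma Zn_y0 [simp]: "yv 0 \<in> Zn n"
  by (simp add: Zn_eq xder_yv_if)

section \<open>The exponential of the derivation\<close>

definition flow :: "nat \<Rightarrow> 'a::field_char_0 mpol \<Rightarrow> 'a mpol" where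
  "flow n = pc.ev (\<lambda>m. \<Sum>i\<le>m. cst (1 / fact i) * yv (Suc n) ^ i * yv (m - i))"

text \<open>The derivative of exp(t x) is exp(t x) x. On a variable this is the index shift in the
  exponential series, from i/i! to 1/(i-1)!; the product rule extends it, as \<open>flow n\<close>
  is multiplicative.\<close>

lemma pdiff_flow:
  fixes p :: "'a::field_char_0 mpol"
  assumes "p \<in> polys_in {..n}"
  shows "pdiff (Suc n) (flow n p) = flow n (xder n p)"
  using assms
proof (induction p rule: polys_in_induct)
  case (yv j p)
  have "pdiff (Suc n) (flow n (yv j)) = (flow n (xder n (yv j)) :: 'a mpol)"
  proof (cases j)
    case 0
    then show ?thesis by (simp add: flow_def xder_yv_if pdiff_yv)
  next
    case (Suc k)
    have "pdiff (Suc n) (flow n (yv j))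
        = (\<Sum>i\<le>j. cst (1 / fact i) * (of_nat i * yv (Suc n) ^ (i - 1)) * yv (j - i) :: 'a mpol)"
      unfolding flow_def pc.ev_yv derivation_sum[OF derivation_pdiff] using yv(1)
      by (intro sum.cong refl)
        (simp add: derivationD[OF derivation_pdiff] derivation_power[OF derivation_pdiff] pdiff_yv)
    also have "\<dots> = (\<Sum>i\<le>k. cst (1 / fact (Suc i)) * (of_nat (Suc i) * yv (Suc n) ^ i) * yv (k - i))"
      unfolding Suc sum.atMost_Suc_shift by simp
    also have "\<dots> = (\<Sum>i\<le>k. cst (1 / fact i) * yv (Suc n) ^ i * yv (k - i))"
    proof (intro sum.cong refl)
      fix i
      have "1 / fact (Suc i) * of_nat (Suc i) = (1 / fact i :: 'a)"
        by (simp add: field_simps del: of_nat_Suc)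
      then have "cst (1 / fact (Suc i)) * of_nat (Suc i) = (cst (1 / fact i) :: 'a mpol)"
        by (metis cst_simps(4,7))
      then show "cst (1 / fact (Suc i)) * (of_nat (Suc i) * yv (Suc n) ^ i) * yv (k - i)
          = (cst (1 / fact i) * yv (Suc n) ^ i * yv (k - i) :: 'a mpol)"
        by (metis mult.assoc)
    qed
    also have "\<dots> = flow n (xder n (yv j))"
      using yv(1) by (simp add: flow_def xder_yv_if Suc)
    finally show ?thesis .
  qed
  moreover have "flow n (p * q) = flow n p * flow n q" "flow n (p + q) = flow n p + flow n q" for p q :: "'a mpol"
    by (simp_all add: flow_def pc.ev_hom)
  ultimately show ?case
    using yv by (simp add: derivationD[OF derivation_pdiff] xder_simps)
next
  case (add p q)
  then show ?case
    by (simp add: flow_def pc.ev_hom derivationD[OF derivation_pdiff] xder_simps)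
qed (simp add: flow_def derivationD[OF derivation_pdiff] xder_simps)

text \<open>The substitution \<^const>\<open>flow\<close> is \<open>exp (t x)\<close> with \<open>t\<close> the variable \<open>yv (Suc n)\<close>; an invariant is
  constant along it, so it may be evaluated at \<open>t = 0\<close> and at any other \<open>t\<close>.\<close>

lemma invariant_along_flow:
  fixes f :: "'a::field_char_0 mpol"
  assumes "f \<in> Zn n"
  shows "fr.ev (\<lambda>m. \<Sum>i\<le>m. to_rat (cst (1 / fact i)) * t ^ i * to_rat (yv (m - i))) f = to_rat f"
proof -
  let ?g = "\<lambda>t i. if i = Suc n then t else to_rat (yv i)"
  have f: "f \<in> polys_in {..n}" "xder n f = 0" using assms by (auto simp: Zn_eq)
  have "flow n f \<in> polys_in (insert (Suc n) {..n})"
    unfolding flow_def using f(1) by (rule pc_ev_in_polys_in) (auto intro!: polys_in_intros polys_in_cst polys_in_yv)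
  moreover have "pdiff (Suc n) (flow n f) = 0"
    using pdiff_flow[OF f(1)] f(2) by (simp add: flow_def)
  ultimately have fl: "flow n f \<in> polys_in {..n}"
    by (rule pdiff_eq_0_iff)
  have ev: "fr.ev (?g t) (flow n f)
      = fr.ev (\<lambda>m. \<Sum>i\<le>m. to_rat (cst (1 / fact i)) * t ^ i * to_rat (yv (m - i))) f" for t
    unfolding flow_def fr.ev_comp
    using f(1) by (rule fr.ev_cong) (auto simp: fr.ev_hom intro!: sum.cong)
  have "fr.ev (?g t) (flow n f) = fr.ev (?g 0) (flow n f)"
    using fl by (rule fr.ev_cong) simp
  also have "\<dots> = fr.ev (\<lambda>i. to_rat (yv i)) f"
    unfolding ev by (rule fr.ev_cong[OF polys_in_UNIV])
      (simp add: power_0_left if_distrib[of "\<lambda>x. _ * x * _"] sum.delta to_rat_1 cong: if_cong)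
  finally show ?thesis
    unfolding ev by (simp add: fr_ev_yv)
qed

lemma to_rat_power: "to_rat (p ^ k) = to_rat p ^ k"
  by (induction k) (simp_all add: to_rat_1 to_rat_mult)

lemma to_rat_sum: "to_rat (sum f A) = (\<Sum>x\<in>A. to_rat (f x))"
  by (induction A rule: infinite_finite_induct) (simp_all add: to_rat_0 to_rat_add del: add_fract)

text \<open>The image of \<open>y\<^sub>m\<close> under the flow at \<open>t = - y\<^sub>1 / y\<^sub>0\<close>.\<close>

definition slice :: "nat \<Rightarrow> 'a::field mpol fract" where
  "slice m = (if m = 0 then to_rat (yv 0) else if m = 1 then 0
     else to_rat (ws m) * inverse (to_rat (yv 0)) ^ (m - 1))"

text \<open>Multiplication by y_0^(m-1) clears the denominators: the terms with i < m become the sum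
  in \<open>ws m\<close>, and the last one, where a factor y_0 is available, becomes the pure power
  of y_1.\<close>

lemma slice_eq:
  "(\<Sum>i\<le>m. to_rat (cst (1 / fact i)) * (- to_rat (yv 1) / to_rat (yv 0)) ^ i * to_rat (yv (m - i)))
     = (slice m :: 'a::field_char_0 mpol fract)"
proof -
  define y where "y i = to_rat (yv i :: 'a mpol)" for i
  define c where "c a = to_rat (cst a :: 'a mpol)" for a
  have y0: "y 0 \<noteq> 0" by (simp add: y_def to_rat_eq_0_iff)
  have c: "c 1 = 1" "c (a * b) = c a * c b" "c (- a) = - c a" for a b
    by (simp_all add: c_def to_rat_1 to_rat_mult to_rat_uminus del: mult_fract minus_fract)
  then have cp: "c ((-1) ^ i) = (-1) ^ i" for i by (induction i) simp_all
  have pow: "(- y 1 / y 0) ^ i = c ((-1) ^ i) * y 1 ^ i / y 0 ^ i" for i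
  proof -
    have "- y 1 / y 0 = (-1) * (y 1 / y 0)" by simp
    then show ?thesis by (simp only: power_mult_distrib power_divide cp times_divide_eq_right)
  qed
  have "(\<Sum>i\<le>m. c (1 / fact i) * (- y 1 / y 0) ^ i * y (m - i)) = slice m"
  proof (cases "m < 2")
    \<comment> \<open>The two lowest indices are separate: y_1 flows to 0, whereas
      \<open>ws 1\<close> is y_0 by convention.\<close>
    case True
    then consider "m = 0" | "m = 1" by linarith
    then show ?thesis using y0 by cases (simp_all add: slice_def c flip: y_def)
  next
    case False
    have "y 0 ^ (m - 1) * (c (1 / fact i) * (- y 1 / y 0) ^ i * y (m - i))
        = c ((-1) ^ i / of_nat (fact i)) * y 0 ^ (m - 1 - i) * y 1 ^ i * y (m - i)" if "i < m" for i
    proof -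
      have "y 0 ^ (m - 1) = y 0 ^ (m - 1 - i) * y 0 ^ i"
        using that by (simp flip: power_add)
      moreover have "c ((-1) ^ i / of_nat (fact i)) = c ((-1) ^ i) * c (1 / fact i)"
        by (simp flip: c(2))
      ultimately show ?thesis using y0 unfolding pow by simp
    qed
    moreover have "y 0 ^ (m - 1) * (c (1 / fact m) * (- y 1 / y 0) ^ m * y 0) = c ((-1) ^ m / of_nat (fact m)) * y 1 ^ m"
    proof -
      have "y 0 ^ (m - 1) * y 0 = y 0 ^ m"
        using False by (simp flip: power_Suc2)
      moreover have "c ((-1) ^ m / of_nat (fact m)) = c ((-1) ^ m) * c (1 / fact m)"
        by (simp flip: c(2))
      ultimately show ?thesis using y0 unfolding pow by (simp add: field_simps)
    qed
    ultimately have "y 0 ^ (m - 1) * (\<Sum>i\<le>m. c (1 / fact i) * (- y 1 / y 0) ^ i * y (m - i))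
      = (\<Sum>i<m. c ((-1) ^ i / of_nat (fact i)) * y 0 ^ (m - 1 - i) * y 1 ^ i * y (m - i))
        + c ((-1) ^ m / of_nat (fact m)) * y 1 ^ m"
      unfolding lessThan_Suc_atMost[symmetric] sum.lessThan_Suc distrib_left sum_distrib_left
      by (intro arg_cong2[where f = "(+)"] sum.cong refl) (simp_all only: lessThan_iff diff_self_eq_0)
    also have "\<dots> = to_rat (ws m)"
    proof -
      have ws: "ws m = cst ((-1) ^ m / of_nat (fact m)) * yv 1 ^ m
        + (\<Sum>i<m. cst ((-1) ^ i / of_nat (fact i)) * yv 0 ^ (m - 1 - i) * yv 1 ^ i * yv (m - i) :: 'a mpol)"
        using False by (simp add: ws_def)
      show ?thesis
        unfolding c_def y_def ws by (simp only: to_rat_add to_rat_mult to_rat_sum to_rat_power add.commute)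
    qed
    finally have "y 0 ^ (m - 1) * (\<Sum>i\<le>m. c (1 / fact i) * (- y 1 / y 0) ^ i * y (m - i)) = to_rat (ws m)" .
    then have "(\<Sum>i\<le>m. c (1 / fact i) * (- y 1 / y 0) ^ i * y (m - i)) = to_rat (ws m) / y 0 ^ (m - 1)"
      using y0 by (simp add: field_simps)
    then show ?thesis
      using False by (simp add: slice_def divide_inverse power_inverse flip: y_def)
  qed
  then show ?thesis unfolding y_def c_def .
qed

text \<open>The flow at -y_1/y_0 in its working form. It writes an invariant through y_0, its
  inverse and the w_m, and applied to the leading terms of the z_m it also brings in the first
  sequence.\<close>

lemma ev_slice: "f \<in> Zn n \<Longrightarrow> fr.ev slice f = (to_rat f :: 'a::field_char_0 mpol fract)"
  using invariant_along_flow[of f n "- to_rat (yv 1) / to_rat (yv 0)"] unfolding slice_eq .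

text \<open>Applying x to the sum in \<open>ws m\<close> telescopes, and the remaining boundary term
  cancels against the image of the pure power of y_1.\<close>

lemma ws_in_Zn:
  assumes "1 \<le> m" "m \<le> n"
  shows "(ws m :: 'a::field_char_0 mpol) \<in> Zn n"
proof (cases "m = 1")
  case False
  define a where "a i = (cst ((-1) ^ i / of_nat (fact i)) :: 'a mpol)" for i :: nat
  \<comment> \<open>\<open>S (Suc i)\<close> is the part of x applied to term i in which the last
    factor is lowered; lowering the power of y_1 in term i gives \<open>- S i\<close>.\<close>
  define S where "S i = (if i = 0 then 0 else a (i - 1) * yv 0 ^ (m - i) * yv 1 ^ (i - 1) * yv (m - i))" for i
  have a_Suc: "a (Suc i) * of_nat (Suc i) = - a i" for i
  proof -
    have "(-1) ^ Suc i / of_nat (fact (Suc i)) * of_nat (Suc i) = - ((-1) ^ i / of_nat (fact i) :: 'a)"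
    proof -
      have "of_nat (fact (Suc i)) = of_nat (Suc i) * (of_nat (fact i) :: 'a)"
        by (simp only: fact_Suc of_nat_mult of_nat_id)
      then show ?thesis by (simp add: field_simps del: of_nat_Suc fact_Suc of_nat_fact)
    qed
    then show ?thesis unfolding a_def by (metis cst_simps(4,5,7))
  qed
  have xder_a: "xder n (a i * p) = a i * xder n p" for i p
    unfolding a_def by (simp add: xder_simps del: cst_simps)
  have a0: "xder n (a i) = 0" for i
    unfolding a_def by (rule derivationD(3)[OF derivation_xder])
  have y1: "xder n (yv 1) = (yv 0 :: 'a mpol)" using assms by (simp add: xder_yv_if)
  have y0: "xder n (yv 0 ^ k * p) = yv 0 ^ k * xder n p" for k and p :: "'a mpol"
    by (simp add: xder_simps xder_yv_if)
  have telescope: "xder n (a i * yv 0 ^ (m - 1 - i) * yv 1 ^ i * yv (m - i)) = S (Suc i) - S i"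
    if "i < m" for i
  proof -
    have "xder n (a i * yv 0 ^ (m - 1 - i) * yv 1 ^ i * yv (m - i))
       = a i * yv 0 ^ (m - 1 - i) * (yv 1 ^ i * yv (m - Suc i) + of_nat i * yv 1 ^ (i - 1) * yv 0 * yv (m - i))"
      using that assms by (simp add: xder_a a0 y0 y1[unfolded One_nat_def] mult.assoc xder_simps xder_yv_if algebra_simps)
    also have "\<dots> = S (Suc i) - S i"
    proof (cases i)
      case (Suc j)
      have "a i * yv 0 ^ (m - 1 - i) * (of_nat i * yv 1 ^ (i - 1) * yv 0 * yv (m - i))
         = (a (Suc j) * of_nat (Suc j)) * (yv 0 ^ (m - 1 - i) * yv 0) * yv 1 ^ j * yv (m - i)"
        by (simp add: Suc mult_ac)
      also have "yv 0 ^ (m - 1 - i) * yv 0 = (yv 0 ^ (m - i) :: 'a mpol)"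
        using that by (metis Suc_diff_Suc diff_Suc_eq_diff_pred power_Suc2 diff_commute)
      finally have "a i * yv 0 ^ (m - 1 - i) * (of_nat i * yv 1 ^ (i - 1) * yv 0 * yv (m - i)) = - S i"
        unfolding a_Suc by (simp add: S_def Suc mult.assoc)
      then show ?thesis by (simp add: distrib_left S_def mult.assoc)
    qed (simp add: S_def)
    finally show ?thesis .
  qed
  have "xder n (a m * yv 1 ^ m) = a m * of_nat m * (yv 1 ^ (m - 1) * yv 0)"
    by (simp only: xder_a derivation_power[OF derivation_xder] y1 mult.assoc)
  also have "\<dots> = - S m"
    using assms a_Suc[of "m - 1"] by (simp add: S_def mult.assoc)
  finally have "xder n (a m * yv 1 ^ m) = - S m" .
  moreover have "ws m = a m * yv 1 ^ m + (\<Sum>i<m. a i * yv 0 ^ (m - 1 - i) * yv 1 ^ i * yv (m - i))"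
    using False by (simp add: ws_def a_def)
  ultimately have "xder n (ws m) = - S m + (\<Sum>i<m. S (Suc i) - S i)"
    using telescope by (simp only: derivationD(1)[OF derivation_xder] derivation_sum[OF derivation_xder]) simp
  then have "xder n (ws m) = (0 :: 'a mpol)"
    unfolding sum_lessThan_telescope by (simp add: S_def)
  moreover have "(ws m :: 'a mpol) \<in> polys_in {..n}"
    using assms False by (auto simp: ws_def intro!: polys_in_intros polys_in_cst polys_in_yv)
  ultimately show ?thesis by (simp add: Zn_eq)
qed (simp add: ws_def)

subsection \<open>The first sequence\<close>

lemma pdiff_notin: "p \<in> polys_in V \<Longrightarrow> i \<notin> V \<Longrightarrow> pdiff i p = 0"
  by (rule derivation_eqI[OF derivation_pdiff, where E = "\<lambda>_. 0"]) (auto simp: derivation_def pdiff_yv)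

lemma hhat_yv:
  assumes "i \<le> n"
  shows "hhat n (yv i) = cst (of_nat n - 2 * of_nat i) * (yv i :: 'a::field mpol)"
proof -
  have "xder n (fhat n (yv i)) = of_nat ((i + 1) * (n - i)) * (yv i :: 'a mpol)"
    using assms by (cases "i = n") (simp_all add: fhat_yv xder_simps xder_yv_if)
  moreover have "fhat n (xder n (yv i)) = of_nat (i * (n + 1 - i)) * (yv i :: 'a mpol)"
    using assms by (cases "i = 0")
      (auto simp: xder_yv_if fhat_yv derivationD[OF derivation_fhat] Suc_diff_le)
  moreover have "of_nat ((i + 1) * (n - i)) - of_nat (i * (n + 1 - i)) = (of_nat n - 2 * of_nat i :: 'a mpol)"
  proof -
    obtain k where "n = i + k" using assms le_Suc_ex by blast
    then have "n - i = k" "n + 1 - i = Suc k" "n = i + k" by simp_all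
    then show ?thesis by (simp add: algebra_simps)
  qed
  ultimately have "hhat n (yv i) = (of_nat n - 2 * of_nat i) * (yv i :: 'a mpol)"
    by (simp only: hhat_def flip: left_diff_distrib)
  then show ?thesis by simp
qed

lemma weight_eq:
  assumes "hhat n u = cst a * u" "u \<noteq> 0"
  shows "weight n u = a"
  unfolding weight_def using assms by (intro the_equality) auto

text \<open>y_0 has weight n, so the normalisation at step k+1 is 1/((k+1)(n-k)), which cancels the
  coefficient in \<open>fhat n (yv k)\<close>.\<close>

lemma fseq_y0:
  assumes "k \<le> n"
  shows "fseq n (yv 0) k = (yv k :: 'a::field_char_0 mpol)"
  using assms
proof (induction k)
  case (Suc k)
  have w: "weight n (yv 0) = (of_nat n :: 'a)"
    by (rule weight_eq) (simp_all add: hhat_yv)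
  have "fhat n (yv k) = cst (of_nat ((k + 1) * (n - k))) * (yv (Suc k) :: 'a mpol)"
    using Suc.prems by (simp only: fhat_yv cst_simps(7)) simp
  then have "fseq n (yv 0) (Suc k)
     = cst (1 / (of_nat (Suc k) * (of_nat n - of_nat (Suc k) + 1)) * of_nat ((k + 1) * (n - k))) * (yv (Suc k) :: 'a mpol)"
    using Suc by (simp only: fseq.simps w cst_simps(4) mult.assoc)
  also have "1 / (of_nat (Suc k) * (of_nat n - of_nat (Suc k) + 1)) * of_nat ((k + 1) * (n - k)) = (1 :: 'a)"
  proof -
    have "of_nat n - of_nat (Suc k) + 1 = (of_nat (n - k) :: 'a)" using Suc by (simp add: of_nat_diff)
    moreover have "of_nat ((k + 1) * (n - k)) = of_nat (Suc k) * (of_nat (n - k) :: 'a)"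
      by (simp only: Suc_eq_plus1 of_nat_mult)
    ultimately show ?thesis using Suc.prems by (simp only:) (simp del: of_nat_Suc)
  qed
  finally show ?case by simp
qed simp

text \<open>The explicit form of the product of y_0 with itself of order d; it is the same for every
  n with d at most n.\<close>

definition quadric :: "nat \<Rightarrow> 'a::field mpol" where
  "quadric d = (\<Sum>i\<le>d. (-1) ^ i * yv i * yv (d - i))"

lemma circ_y0_y0: "d \<le> n \<Longrightarrow> circ n d (yv 0) (yv 0) = (quadric d :: 'a::field_char_0 mpol)"
  by (simp add: circ_def quadric_def fseq_y0)

lemma minus_one_power_cst: "(-1) ^ i = cst ((-1) ^ i)"
  by simp

text \<open>Another telescoping sum: lowering the second factor of term i gives
  \<open>S (Suc i)\<close>, lowering the first gives \<open>- S i\<close>, and \<open>S\<close>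
  vanishes at both ends.\<close>

lemma xder_quadric:
  assumes "d \<le> n"
  shows "xder n (quadric d) = (0 :: 'a::field mpol)"
proof -
  define S where "S i = (if i = 0 \<or> i > d then 0 else (-1) ^ (i - 1) * yv (i - 1) * yv (d - i) :: 'a mpol)" for i
  have "xder n ((-1) ^ i * yv i * yv (d - i)) = S (Suc i) - S i" if "i < Suc d" for i
    using that assms unfolding minus_one_power_cst mult.assoc derivationD(9)[OF derivation_xder]
    by (cases i) (auto simp: S_def xder_simps xder_yv_if algebra_simps)
  then have "xder n (quadric d :: 'a mpol) = (\<Sum>i<Suc d. S (Suc i) - S i)"
    unfolding quadric_def derivation_sum[OF derivation_xder] lessThan_Suc_atMost[symmetric]
    by (intro sum.cong) auto
  then show ?thesis by (simp only: sum_lessThan_telescope) (simp add: S_def)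
qed

lemma quadric_closed: "d \<le> n \<Longrightarrow> quadric d \<in> polys_in {..n}"
  unfolding quadric_def minus_one_power_cst
  by (intro polys_in_intros polys_in_cst polys_in_yv) auto

lemma hhat_quadric:
  assumes "d \<le> n"
  shows "hhat n (quadric d) = cst (2 * of_nat n - 2 * of_nat d) * (quadric d :: 'a::field mpol)"
  unfolding quadric_def derivation_sum[OF derivation_hhat] sum_distrib_left
proof (intro sum.cong refl)
  fix i assume i: "i \<in> {..d}"
  have "cst (of_nat n - 2 * of_nat i) + cst (of_nat n - 2 * of_nat (d - i)) = (cst (2 * of_nat n - 2 * of_nat d) :: 'a mpol)"
    using i by (simp only: cst_simps(3)[symmetric]) (simp add: of_nat_diff algebra_simps)
  moreover have "hhat n ((-1) ^ i * yv i * yv (d - i))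
     = (cst (of_nat n - 2 * of_nat i) + cst (of_nat n - 2 * of_nat (d - i))) * ((-1) ^ i * yv i * yv (d - i) :: 'a mpol)"
    using i assms unfolding minus_one_power_cst mult.assoc derivationD(9)[OF derivation_hhat]
    by (simp add: derivationD(2)[OF derivation_hhat] hhat_yv algebra_simps del: cst_simps)
  ultimately show "hhat n ((-1) ^ i * yv i * yv (d - i))
     = cst (2 * of_nat n - 2 * of_nat d) * ((-1) ^ i * yv i * yv (d - i) :: 'a mpol)" by simp
qed

text \<open>For even d the two end terms add up to 2 y_0 y_d. For odd d they would cancel, which is
  why the odd members of the sequence are built differently.\<close>

lemma quadric_leading:
  assumes "even d" "d \<ge> 2"
  obtains r where "r \<in> polys_in {..<d}" and "quadric d = 2 * yv 0 * yv d + (r :: 'a::field mpol)"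
proof
  define r :: "'a mpol" where "r = (\<Sum>i\<in>{1..<d}. (-1) ^ i * yv i * yv (d - i))"
  show "r \<in> polys_in {..<d}"
    unfolding r_def minus_one_power_cst using assms
    by (intro polys_in_intros polys_in_cst polys_in_yv) auto
  have "{..d} = insert 0 (insert d {1..<d})" using assms by auto
  then show "quadric d = 2 * yv 0 * yv d + r"
    using assms by (simp add: quadric_def r_def algebra_simps)
qed

text \<open>The derivative in y_d is 2 y_0. Nonvanishing is what makes the weight of the quadric
  well determined.\<close>

lemma quadric_neq_0:
  assumes "even d" "d \<ge> 2"
  shows "quadric d \<noteq> (0 :: 'a::field_char_0 mpol)"
proof
  assume 0: "quadric d = (0 :: 'a mpol)"
  from assms obtain r where r: "r \<in> polys_in {..<d}" "quadric d = 2 * yv 0 * yv d + (r :: 'a mpol)"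
    by (rule quadric_leading)
  have "pdiff d (quadric d) = 2 * (yv 0 :: 'a mpol)"
    using assms pdiff_notin[OF r(1), of d] derivationD(9)[OF derivation_pdiff, of d 2 "yv 0 * yv d"]
    unfolding r(2) by (simp add: derivationD[OF derivation_pdiff] pdiff_yv mult.assoc)
  then show False using 0 by (simp add: derivationD[OF derivation_pdiff])
qed

text \<open>The product of order 1 of y_0 with \<open>quadric d\<close>, whose weight is 2n - 2d.
  For even d this is the member with index d + 1 of the first sequence.\<close>

definition zs_odd :: "nat \<Rightarrow> nat \<Rightarrow> 'a::field mpol" where
  "zs_odd n d = yv 0 * (cst (1 / (2 * of_nat n - 2 * of_nat d)) * fhat n (quadric d)) - yv 1 * quadric d"

lemma circ_1:
  assumes "even d" "d \<ge> 2" "d < n"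
  shows "circ n 1 (yv 0) (quadric d) = (zs_odd n d :: 'a::field_char_0 mpol)"
proof -
  have "weight n (quadric d) = (2 * of_nat n - 2 * of_nat d :: 'a)"
    using assms by (intro weight_eq hhat_quadric quadric_neq_0) auto
  then have f1: "fseq n (quadric d) 1 = cst (1 / (2 * of_nat n - 2 * of_nat d)) * fhat n (quadric d :: 'a mpol)"
    by simp
  have "fseq n (yv 0) 1 = (yv 1 :: 'a mpol)" using assms fseq_y0[of 1 n] by simp
  moreover have "circ n 1 (yv 0) (quadric d) = fseq n (yv 0) 0 * fseq n (quadric d) 1
      - fseq n (yv 0) 1 * fseq n (quadric d :: 'a mpol) 0"
    by (simp add: circ_def del: fseq.simps)
  ultimately show ?thesis unfolding zs_odd_def f1 by simp
qed

lemma fhat_closed: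
  assumes "p \<in> polys_in {..m}" "m < n"
  shows "fhat n p \<in> polys_in {..Suc m}"
  using derivation_fhat assms(1)
  by (rule derivation_closed) (use assms(2) in \<open>auto simp: fhat_yv intro!: polys_in_intros polys_in_yv simp del: of_nat_mult\<close>)

text \<open>Since the quadric q is killed by x and the weight operator is the commutator of x and
  \<open>fhat n\<close>, x maps \<open>fhat n q\<close> to (2n - 2d) q. The normalisation turns this
  into q, and the two copies of y_0 q cancel.\<close>

lemma zs_odd_in_Zn:
  assumes "d < n"
  shows "(zs_odd n d :: 'a::field_char_0 mpol) \<in> Zn n"
proof -
  let ?a = "2 * of_nat n - 2 * of_nat d :: 'a"
  have a: "?a \<noteq> 0" using assms by simp
  have "xder n (fhat n (quadric d)) = cst ?a * (quadric d :: 'a mpol)"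
    using hhat_quadric[of d n, where 'a = 'a] xder_quadric[of d n, where 'a = 'a] assms
    by (simp add: hhat_def derivationD[OF derivation_fhat])
  then have "xder n (zs_odd n d) = yv 0 * (cst (1 / ?a * ?a) * quadric d) - yv 0 * (quadric d :: 'a mpol)"
    using assms xder_quadric[of d n, where 'a = 'a]
    unfolding zs_odd_def cst_simps(4)
    by (simp add: derivationD(2,3,7)[OF derivation_xder] xder_yv_if mult.assoc del: cst_simps)
  also have "1 / ?a * ?a = 1" using a by simp
  finally have "xder n (zs_odd n d :: 'a mpol) = 0" by simp
  moreover have "fhat n (quadric d :: 'a mpol) \<in> polys_in {..n}"
    by (rule polys_in_mono[OF _ fhat_closed[OF quadric_closed[OF order_refl] assms]]) (use assms in auto)
  ultimately show ?thesis
    unfolding Zn_eq zs_odd_def using assms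
    by (auto intro!: polys_in_intros quadric_closed simp del: cst_simps)
qed

text \<open>Only raising y_d in the leading term 2 y_0 y_d creates y_(d+1). The remainder of the
  quadric uses variables below y_d and is raised to y_d at most.\<close>

lemma zs_odd_leading:
  assumes "even d" "d \<ge> 2" "d < n"
  shows "\<exists>c r. c \<noteq> 0 \<and> r \<in> polys_in {..<Suc d} \<and> zs_odd n d = cst c * yv 0 ^ 2 * yv (Suc d) + (r :: 'a::field_char_0 mpol)"
proof -
  let ?a = "2 * of_nat n - 2 * of_nat d :: 'a"
  from assms obtain r where r: "r \<in> polys_in {..<d}" "quadric d = 2 * yv 0 * yv d + (r :: 'a mpol)"
    by (metis quadric_leading)
  define k :: 'a where "k = of_nat ((d + 1) * (n - d))"
  define s where "s = yv 0 * (cst (1 / ?a) * (2 * fhat n (yv 0) * yv d + fhat n r)) - yv 1 * quadric d"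
  have two: "cst 2 = (2 :: 'a mpol)" by simp
  have "fhat n (yv d) = cst k * yv (Suc d)"
    using assms by (simp add: fhat_yv k_def del: of_nat_mult)
  then have "fhat n (quadric d) = 2 * cst k * yv 0 * yv (Suc d) + (2 * fhat n (yv 0) * yv d + fhat n r)"
    unfolding r(2) using derivationD(9)[OF derivation_fhat, of n 2 "yv 0 * yv d"]
    by (simp add: derivationD[OF derivation_fhat] algebra_simps)
  then have "zs_odd n d = cst (1 / ?a * (2 * k)) * yv 0 ^ 2 * yv (Suc d) + s"
    unfolding zs_odd_def s_def cst_simps(4) by (simp add: power2_eq_square algebra_simps two del: cst_simps)
  moreover have "1 / ?a * (2 * k) \<noteq> 0"
  proof -
    have "k \<noteq> 0" "?a \<noteq> 0" using assms unfolding k_def of_nat_eq_0_iff by simp_all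
    then show ?thesis by simp
  qed
  moreover have "s \<in> polys_in {..<Suc d}"
  proof -
    have "r \<in> polys_in {..d - 1}" by (rule polys_in_mono[OF _ r(1)]) (use assms in auto)
    then have "fhat n r \<in> polys_in {..Suc (d - 1)}" by (rule fhat_closed) (use assms in auto)
    moreover have "(2 :: 'a mpol) \<in> polys_in {..d}" using polys_in_of_nat[of 2] by simp
    ultimately show ?thesis
      using assms quadric_closed[of d d] unfolding s_def lessThan_Suc_atMost
      by (auto intro!: polys_in_intros simp: fhat_yv)
  qed
  ultimately show ?thesis by blast
qed

lemma zs_cases:
  assumes "2 \<le> i" "i \<le> n"
  shows "zs n i = (if even i then quadric i else zs_odd n (i - 1) :: 'a::field_char_0 mpol)"
proof (cases "even i")
  case False
  then have "3 \<le> i" using assms by presburger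
  then show ?thesis
    using False assms circ_1[of "i - 1" n, where 'a = 'a] by (auto simp: zs_def circ_y0_y0)
qed (use assms in \<open>auto simp: zs_def circ_y0_y0\<close>)

lemma zs_in_Zn:
  assumes "1 \<le> i" "i \<le> n"
  shows "(zs n i :: 'a::field_char_0 mpol) \<in> Zn n"
proof (cases "i = 1")
  case False
  then show ?thesis
    using assms zs_odd_in_Zn[of "i - 1" n, where 'a = 'a] by (simp add: zs_cases) (simp add: Zn_eq quadric_closed xder_quadric)
qed (simp add: zs_def)

text \<open>The triangular shape that allows y_m to be solved for recursively; the exponent
  \<open>e\<close> is 1 for even and 2 for odd index.\<close>

lemma zs_leading:
  assumes "2 \<le> i" "i \<le> n"
  shows "\<exists>c e r. c \<noteq> 0 \<and> r \<in> polys_in {..<i} \<and> zs n i = cst c * yv 0 ^ e * yv i + (r :: 'a::field_char_0 mpol)"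
proof (cases "even i")
  case True
  then obtain r where "r \<in> polys_in {..<i}" "quadric i = 2 * yv 0 * yv i + (r :: 'a mpol)"
    using assms by (metis quadric_leading)
  moreover have "cst 2 = (2 :: 'a mpol)"
    using cst_simps(7)[of 2] by simp
  ultimately show ?thesis
    using True assms by (intro exI[of _ 2] exI[of _ 1] exI[of _ r]) (simp add: zs_cases)
next
  case False
  then have "even (i - 1)" "2 \<le> i - 1" "i - 1 < n" and i: "Suc (i - 1) = i" using assms by presburger+
  from zs_odd_leading[OF this(1-3), where 'a = 'a] show ?thesis
    using False assms unfolding i zs_cases[OF assms] by auto
qed

subsection \<open>Generators\<close>

lemma a_inv_ring_of_type_algebra: "\<ominus>\<^bsub>ring_of_type_algebra\<^esub> x = - x"
  unfolding a_inv_def m_inv_def ring_of_type_algebra_def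
  by (rule the_equality) (auto simp: eq_neg_iff_add_eq_0 add.commute)

lemma m_inv_ring_of_type_algebra: "x \<noteq> 0 \<Longrightarrow> inv\<^bsub>ring_of_type_algebra\<^esub> x = inverse (x :: 'b::field)"
  unfolding m_inv_def ring_of_type_algebra_def
  by (rule the_equality) (auto simp: inverse_unique)

lemma gen_subalgebra_closed:
  shows gen_subalgebra_const: "to_rat (cst c) \<in> gen_subalgebra H"
    and gen_subalgebra_gen: "x \<in> H \<Longrightarrow> x \<in> gen_subalgebra H"
    and gen_subalgebra_add: "x \<in> gen_subalgebra H \<Longrightarrow> y \<in> gen_subalgebra H \<Longrightarrow> x + y \<in> gen_subalgebra H"
    and gen_subalgebra_mult: "x \<in> gen_subalgebra H \<Longrightarrow> y \<in> gen_subalgebra H \<Longrightarrow> x * y \<in> gen_subalgebra H"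
    and gen_subalgebra_uminus: "x \<in> gen_subalgebra H \<Longrightarrow> - x \<in> gen_subalgebra H"
  unfolding gen_subalgebra_def
  using generate_ring.eng_add[of x ring_of_type_algebra _ y] generate_ring.eng_mult[of x ring_of_type_algebra _ y]
    generate_ring.a_inv[of x ring_of_type_algebra]
  by (auto intro: generate_ring.incl simp: a_inv_ring_of_type_algebra)

lemma gen_subalgebra_power: "x \<in> gen_subalgebra H \<Longrightarrow> x ^ k \<in> gen_subalgebra H"
  by (induction k) (use gen_subalgebra_const[of 1 H] in \<open>simp_all add: to_rat_1 gen_subalgebra_mult\<close>)

lemma gen_subfield_closed:
  shows gen_subfield_const: "to_rat (cst c) \<in> gen_subfield H"
    and gen_subfield_gen: "x \<in> H \<Longrightarrow> x \<in> gen_subfield H"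
    and gen_subfield_add: "x \<in> gen_subfield H \<Longrightarrow> y \<in> gen_subfield H \<Longrightarrow> x + y \<in> gen_subfield H"
    and gen_subfield_mult: "x \<in> gen_subfield H \<Longrightarrow> y \<in> gen_subfield H \<Longrightarrow> x * y \<in> gen_subfield H"
    and gen_subfield_uminus: "x \<in> gen_subfield H \<Longrightarrow> - x \<in> gen_subfield H"
    and gen_subfield_inverse: "x \<in> gen_subfield H \<Longrightarrow> x \<noteq> 0 \<Longrightarrow> inverse x \<in> gen_subfield H"
  unfolding gen_subfield_def
  using generate_field.eng_add[of x ring_of_type_algebra _ y] generate_field.eng_mult[of x ring_of_type_algebra _ y]
    generate_field.a_inv[of x ring_of_type_algebra] generate_field.m_inv[of x ring_of_type_algebra]
  by (auto intro: generate_field.incl simp: a_inv_ring_of_type_algebra m_inv_ring_of_type_algebra)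

lemma gen_subalgebra_subset:
  assumes "x \<in> gen_subalgebra H" and "H \<subseteq> S" and "range (\<lambda>c. to_rat (cst c)) \<subseteq> S"
    and "\<And>x y. x \<in> S \<Longrightarrow> y \<in> S \<Longrightarrow> x + y \<in> S" and "\<And>x y. x \<in> S \<Longrightarrow> y \<in> S \<Longrightarrow> x * y \<in> S"
    and "\<And>x. x \<in> S \<Longrightarrow> - x \<in> S"
  shows "x \<in> S"
  using assms(1) unfolding gen_subalgebra_def
proof (induction rule: generate_ring.induct)
  case one
  have "to_rat (cst 1) \<in> S" using assms(3) by blast
  then show ?case by (simp add: to_rat_1 ring_of_type_algebra_def)
next
  case (a_inv h)
  then show ?case by (simp add: a_inv_ring_of_type_algebra assms)
qed (use assms(2-5) in \<open>auto simp: ring_of_type_algebra_def\<close>)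

lemma gen_subfield_subset:
  assumes "x \<in> gen_subfield H" and "H \<subseteq> S" and "range (\<lambda>c. to_rat (cst c)) \<subseteq> S"
    and "\<And>x y. x \<in> S \<Longrightarrow> y \<in> S \<Longrightarrow> x + y \<in> S" and "\<And>x y. x \<in> S \<Longrightarrow> y \<in> S \<Longrightarrow> x * y \<in> S"
    and "\<And>x. x \<in> S \<Longrightarrow> - x \<in> S" and "\<And>x. x \<in> S \<Longrightarrow> x \<noteq> 0 \<Longrightarrow> inverse x \<in> S"
  shows "x \<in> S"
  using assms(1) unfolding gen_subfield_def
proof (induction rule: generate_field.induct)
  case one
  have "to_rat (cst 1) \<in> S" using assms(3) by blast
  then show ?case by (simp add: to_rat_1 ring_of_type_algebra_def)
next
  case (a_inv h)
  then show ?case by (simp add: a_inv_ring_of_type_algebra assms)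
next
  case (m_inv h)
  then have "h \<noteq> 0" by (simp add: ring_of_type_algebra_def)
  then show ?case using m_inv assms(7) by (simp add: m_inv_ring_of_type_algebra)
qed (use assms(2-5) in \<open>auto simp: ring_of_type_algebra_def\<close>)

text \<open>By \<open>ev_slice\<close> an invariant is a polynomial in the slices, so only these
  have to be produced from the generators.\<close>

lemma Zn_subset_gen_subalgebra:
  fixes H :: "'a::field_char_0 mpol fract set"
  assumes "\<And>m. m \<le> n \<Longrightarrow> slice m \<in> gen_subalgebra H"
  shows "to_rat ` Zn n \<subseteq> gen_subalgebra H"
proof
  fix x :: "'a mpol fract" assume "x \<in> to_rat ` Zn n"
  then obtain f where f: "f \<in> Zn n" "x = to_rat f" by blast
  then have "f \<in> polys_in {..n}" by (simp add: Zn_eq)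
  then have "fr.ev slice f \<in> gen_subalgebra H"
    by (rule fr.ev_closed) (auto intro: assms gen_subalgebra_closed)
  then show "x \<in> gen_subalgebra H" using f ev_slice by metis
qed

lemma slice_0_1_in:
  assumes "to_rat (yv 0) \<in> gen_subalgebra H" and "m < 2"
  shows "slice m \<in> gen_subalgebra H"
proof -
  have "0 \<in> gen_subalgebra H" using gen_subalgebra_const[of 0 H] by (simp add: to_rat_0)
  then show ?thesis using assms by (auto simp: slice_def)
qed

theorem Zn_subset_ws:
  assumes "n \<ge> 1"
  shows "to_rat ` Zn n
    \<subseteq> gen_subalgebra (insert (inverse (to_rat (yv 0))) (to_rat ` ws ` {1..n} :: 'a::field_char_0 mpol fract set))"
proof (rule Zn_subset_gen_subalgebra)
  fix m assume m: "m \<le> n"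
  let ?H = "insert (inverse (to_rat (yv 0))) (to_rat ` ws ` {1..n} :: 'a mpol fract set)"
  have ws: "to_rat (ws i) \<in> gen_subalgebra ?H" if "1 \<le> i" "i \<le> n" for i
    using that by (intro gen_subalgebra_gen) auto
  have "inverse (to_rat (yv 0)) \<in> gen_subalgebra ?H"
    by (rule gen_subalgebra_gen) simp
  then show "slice m \<in> gen_subalgebra ?H"
    using ws[of 1] ws[of m] m assms slice_0_1_in[of ?H m]
    by (cases "m < 2") (auto simp: ws_def slice_def intro: gen_subalgebra_mult gen_subalgebra_power)
qed

text \<open>Evaluation at the slices fixes the invariant z_m and turns its triangular form into c
  y_0^e \<open>slice m\<close> plus a polynomial in earlier slices. Strong induction solves for
  \<open>slice m\<close>, dividing by c and powers of y_0 only.\<close>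

theorem Zn_subset_zs:
  assumes "n \<ge> 1"
  shows "to_rat ` Zn n
    \<subseteq> gen_subalgebra (insert (inverse (to_rat (yv 0))) (to_rat ` zs n ` {1..n} :: 'a::field_char_0 mpol fract set))"
proof (rule Zn_subset_gen_subalgebra)
  let ?H = "insert (inverse (to_rat (yv 0))) (to_rat ` zs n ` {1..n} :: 'a mpol fract set)"
  let ?y = "to_rat (yv 0 :: 'a mpol)"
  have zs: "to_rat (zs n i) \<in> gen_subalgebra ?H" if "1 \<le> i" "i \<le> n" for i
    using that by (intro gen_subalgebra_gen) auto
  have inv: "inverse ?y \<in> gen_subalgebra ?H"
    by (rule gen_subalgebra_gen) simp
  fix m assume "m \<le> n"
  then show "slice m \<in> gen_subalgebra ?H"
  proof (induction m rule: less_induct)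
    case (less m)
    show ?case
    proof (cases "m < 2")
      case True
      then show ?thesis using zs[of 1] assms slice_0_1_in by (auto simp: zs_def)
    next
      case False
      then obtain c e r where z: "c \<noteq> 0" "r \<in> polys_in {..<m}" "zs n m = cst c * yv 0 ^ e * yv m + (r :: 'a mpol)"
        using zs_leading[of m n, where 'a = 'a] less by auto
      have "to_rat (zs n m) = fr.ev slice (zs n m :: 'a mpol)"
        using zs_in_Zn[of m n, where 'a = 'a] False less by (simp add: ev_slice)
      also have "\<dots> = to_rat (cst c) * ?y ^ e * slice m + fr.ev slice r"
        by (simp only: z fr.ev_hom fr.ev_cst fr.ev_yv) (simp add: slice_def)
      finally have "slice m = (to_rat (zs n m) + - fr.ev slice r) * (inverse (to_rat (cst c)) * inverse ?y ^ e)"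
        using z(1) by (simp add: field_simps to_rat_eq_0_iff del: mult_fract add_fract minus_fract)
      moreover have "inverse (to_rat (cst c)) = to_rat (cst (1 / c) :: 'a mpol)"
        using z(1) by (intro inverse_unique) (simp add: to_rat_1 flip: cst_simps(4))
      moreover have "fr.ev slice r \<in> gen_subalgebra ?H"
        using z(2) by (rule fr.ev_closed) (use less in \<open>auto intro: gen_subalgebra_closed\<close>)
      moreover have "to_rat (zs n m) \<in> gen_subalgebra ?H"
        using zs[of m] False less by simp
      ultimately show ?thesis
        by (simp only: gen_subalgebra_add gen_subalgebra_mult gen_subalgebra_uminus gen_subalgebra_power
            gen_subalgebra_const inv)
    qed
  qed
qed

text \<open>Common to both sequences. As y_0 lies in \<open>U\<close>, the field generated by
  \<open>U\<close> contains its inverse and hence every invariant; conversely, fractions of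
  invariants are closed under the field operations.\<close>

lemma frac_field_of_Zn:
  fixes U :: "'a::field_char_0 mpol set"
  assumes "U \<subseteq> Zn n" and "yv 0 \<in> U"
    and "to_rat ` Zn n \<subseteq> gen_subalgebra (insert (inverse (to_rat (yv 0))) (to_rat ` U))"
  shows "frac_field_of (Zn n) = gen_subfield (to_rat ` U)"
proof
  have "to_rat p \<in> gen_subfield (to_rat ` U)" if "p \<in> Zn n" for p
  proof (rule gen_subalgebra_subset)
    show "to_rat p \<in> gen_subalgebra (insert (inverse (to_rat (yv 0))) (to_rat ` U))"
      using assms(3) that by blast
    have "inverse (to_rat (yv 0)) \<in> gen_subfield (to_rat ` U)"
      using assms(2) by (intro gen_subfield_inverse gen_subfield_gen) (auto simp: to_rat_eq_0_iff)
    then show "insert (inverse (to_rat (yv 0))) (to_rat ` U) \<subseteq> gen_subfield (to_rat ` U)"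
      by (auto intro: gen_subfield_gen)
  qed (auto intro: gen_subfield_closed)
  then have "Fract a b \<in> gen_subfield (to_rat ` U)" if "a \<in> Zn n" "b \<in> Zn n" "b \<noteq> 0" for a b
    using that gen_subfield_mult[OF _ gen_subfield_inverse, of "to_rat a" _ "to_rat b"]
    by (simp add: to_rat_eq_0_iff)
  then show "frac_field_of (Zn n) \<subseteq> gen_subfield (to_rat ` U)"
    by (auto simp: frac_field_of_def)
  show "gen_subfield (to_rat ` U) \<subseteq> frac_field_of (Zn n)"
  proof
    have rat: "to_rat p \<in> frac_field_of (Zn n)" if "p \<in> Zn n" for p
      using that Zn_1 one_neq_zero unfolding frac_field_of_def by blast
    have I: "Fract a b \<in> frac_field_of (Zn n)" if "a \<in> Zn n" "b \<in> Zn n" "b \<noteq> 0" for a b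
      using that by (auto simp: frac_field_of_def)
    fix x :: "'a mpol fract" assume "x \<in> gen_subfield (to_rat ` U)"
    then show "x \<in> frac_field_of (Zn n)"
    proof (rule gen_subfield_subset)
      fix x :: "'a mpol fract" assume "x \<in> frac_field_of (Zn n)"
      then obtain a b where x: "x = Fract a b" "a \<in> Zn n" "b \<in> Zn n" "b \<noteq> 0"
        by (auto simp: frac_field_of_def)
      then show "- x \<in> frac_field_of (Zn n)" by (simp add: I Zn_uminus)
      show "inverse x \<in> frac_field_of (Zn n)" if "x \<noteq> 0"
        using that x by (auto intro: I simp: Zero_fract_def eq_fract)
      fix y :: "'a mpol fract" assume "y \<in> frac_field_of (Zn n)"
      then obtain c d where "y = Fract c d" "c \<in> Zn n" "d \<in> Zn n" "d \<noteq> 0"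
        by (auto simp: frac_field_of_def)
      then show "x + y \<in> frac_field_of (Zn n)" "x * y \<in> frac_field_of (Zn n)"
        using x by (simp_all add: I Zn_add Zn_mult)
    qed (use assms(1) in \<open>auto intro: rat\<close>)
  qed
qed

section \<open>Krull dimension\<close>

subsection \<open>Algebraic dependence\<close>

lemma lookup_single_mult:
  fixes p :: "'a::field mpol"
  shows "Poly_Mapping.lookup (Poly_Mapping.single k c * p) (k + m) = c * Poly_Mapping.lookup p m"
  by (induction p rule: poly_mapping_single_induct)
    (simp_all add: mult_single lookup_single when_def distrib_left lookup_add)

text \<open>Bounding each exponent separately, rather than the total degree, makes the number of
  monomials an exact power, which suits the counting argument below.\<close>

definition box :: "nat set \<Rightarrow> nat \<Rightarrow> (nat \<Rightarrow>\<^sub>0 nat) set" where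
  "box V M = {m. Poly_Mapping.keys m \<subseteq> V \<and> (\<forall>i\<in>V. Poly_Mapping.lookup m i < M)}"

lemma box_bij:
  assumes "finite V"
  shows "bij_betw (\<lambda>m. restrict (Poly_Mapping.lookup m) V) (box V M) (PiE V (\<lambda>_. {..<M}))"
proof (rule bij_betw_byWitness[where f' = "\<lambda>f. \<Sum>i\<in>V. Poly_Mapping.single i (f i)"])
  have l: "Poly_Mapping.lookup (\<Sum>i\<in>V. Poly_Mapping.single i (f i)) j = (if j \<in> V then f j else 0)"
    for f :: "nat \<Rightarrow> nat" and j
    using assms by (simp add: lookup_sum lookup_single when_def)
  show "\<forall>m\<in>box V M. (\<Sum>i\<in>V. Poly_Mapping.single i (restrict (Poly_Mapping.lookup m) V i)) = m"
  proof
    fix m assume m: "m \<in> box V M"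
    show "(\<Sum>i\<in>V. Poly_Mapping.single i (restrict (Poly_Mapping.lookup m) V i)) = m"
      by (rule poly_mapping_eqI) (use m in \<open>auto simp: l box_def in_keys_iff\<close>)
  qed
  show "\<forall>f\<in>PiE V (\<lambda>_. {..<M}). restrict (Poly_Mapping.lookup (\<Sum>i\<in>V. Poly_Mapping.single i (f i))) V = f"
    by (auto simp: l fun_eq_iff PiE_def extensional_def)
  show "(\<lambda>f. \<Sum>i\<in>V. Poly_Mapping.single i (f i)) ` PiE V (\<lambda>_. {..<M}) \<subseteq> box V M"
    by (auto simp: box_def l in_keys_iff PiE_def Pi_def split: if_splits)
qed (auto simp: box_def)

lemma card_box: "finite V \<Longrightarrow> card (box V M) = M ^ card V"
  using bij_betw_same_card[OF box_bij] by (simp add: card_PiE)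

lemma finite_box: "finite V \<Longrightarrow> finite (box V M)"
  using bij_betw_finite[OF box_bij] by (simp add: finite_PiE)

definition deg_le :: "nat \<Rightarrow> 'a::field mpol \<Rightarrow> bool" where
  "deg_le C p \<longleftrightarrow> (\<forall>m\<in>Poly_Mapping.keys p. \<forall>i. Poly_Mapping.lookup m i \<le> C)"

lemma deg_le_mult: "deg_le C p \<Longrightarrow> deg_le D q \<Longrightarrow> deg_le (C + D) (p * q)"
  using keys_mult[of p q] unfolding deg_le_def by (force simp: lookup_add intro: add_mono)

lemma deg_le_1: "deg_le 0 1"
  by (simp add: deg_le_def)

lemma deg_le_power: "deg_le C p \<Longrightarrow> deg_le (k * C) (p ^ k)"
  by (induction k) (simp_all add: deg_le_1 deg_le_mult)

lemma deg_le_prod: "(\<And>i. i \<in> A \<Longrightarrow> deg_le (C i) (f i)) \<Longrightarrow> deg_le (\<Sum>i\<in>A. C i) (\<Prod>i\<in>A. f i)"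
  by (induction A rule: infinite_finite_induct) (simp_all add: deg_le_1 deg_le_mult)

lemma deg_le_exists: "\<exists>C. deg_le C p"
proof (induction p rule: mpol_induct)
  case (cst c)
  then show ?case by (auto simp: deg_le_def cst_def)
next
  case (yv i p)
  have "deg_le 1 (yv i :: 'a mpol)" by (simp add: deg_le_def yv_def lookup_single when_def)
  then show ?case using yv deg_le_mult by blast
next
  case (add p q)
  then obtain C D where "deg_le C p" "deg_le D q" by auto
  then have "deg_le (max C D) (p + q)"
    using keys_add[of p q] by (force simp: deg_le_def le_max_iff_disj)
  then show ?case ..
qed

interpretation mpol_vs: vector_space "\<lambda>c (p :: 'a::field mpol). cst c * p"
  by standard (simp_all add: algebra_simps)

lemma in_span_box:
  assumes "p \<in> polys_in W" "deg_le C p" "C < N"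
  shows "p \<in> mpol_vs.span ((\<lambda>m. Poly_Mapping.single m 1) ` box W N)"
proof -
  have "m \<in> box W N" if "m \<in> Poly_Mapping.keys p" for m
  proof -
    have "Poly_Mapping.keys m \<subseteq> W" "\<And>i. Poly_Mapping.lookup m i \<le> C"
      using assms that by (auto simp: polys_in_def deg_le_def)
    then show ?thesis
      using le_less_trans[OF _ assms(3)] by (auto simp: box_def)
  qed
  then have "(\<Sum>m\<in>Poly_Mapping.keys p. cst (Poly_Mapping.lookup p m) * Poly_Mapping.single m 1)
     \<in> mpol_vs.span ((\<lambda>m. Poly_Mapping.single m 1) ` box W N)"
    by (intro mpol_vs.span_sum mpol_vs.span_scale mpol_vs.span_base imageI)
  then show ?thesis
    using poly_mapping_sum_single[of p] by (simp add: cst_def mult_single)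
qed

text \<open>A dimension count. The products of the \<open>g i\<close> with exponents below M number
  M^|V|, counted by exponent vector, and lie in a space spanned by (K M)^|W| monomials; for large M
  there are too many of them to be distinct and linearly independent.\<close>

lemma algebraic_dependence:
  fixes g :: "nat \<Rightarrow> 'a::field mpol"
  assumes "finite V" "finite W" "card W < card V" and g: "\<And>i. i \<in> V \<Longrightarrow> g i \<in> polys_in W"
  shows "\<exists>p\<in>polys_in V. p \<noteq> 0 \<and> pc.ev g p = 0"
proof -
  define C where "C i = (SOME c. deg_le c (g i))" for i
  have C: "deg_le (C i) (g i)" for i
    unfolding C_def by (rule someI_ex[OF deg_le_exists])
  define K where "K = Suc (\<Sum>i\<in>V. C i)"
  \<comment> \<open>Chosen above K^|W|, so that (K M)^|W| < M * M^|W|, which is at most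
    M^|V|.\<close>
  define M where "M = Suc (K ^ card W)"
  let ?B = "(\<lambda>m. Poly_Mapping.single m (1::'a)) ` box W (K * M)"
  let ?F = "\<lambda>e. pc.ev g (Poly_Mapping.single e 1)"
  have F: "?F e = (\<Prod>i\<in>V. g i ^ Poly_Mapping.lookup e i)" if "e \<in> box V M" for e
  proof -
    have "(\<Prod>i\<in>Poly_Mapping.keys e. g i ^ Poly_Mapping.lookup e i) = (\<Prod>i\<in>V. g i ^ Poly_Mapping.lookup e i)"
      using that assms(1) by (intro prod.mono_neutral_left) (auto simp: box_def in_keys_iff)
    then show ?thesis by (simp add: pc.ev_single)
  qed
  have span: "?F e \<in> mpol_vs.span ?B" if e: "e \<in> box V M" for e
  proof (rule in_span_box)
    show "?F e \<in> polys_in W"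
      unfolding F[OF e] using g by (intro polys_in_intros)
    show "deg_le (\<Sum>i\<in>V. Poly_Mapping.lookup e i * C i) (?F e)"
      unfolding F[OF e] by (intro deg_le_prod deg_le_power C)
    have "(\<Sum>i\<in>V. Poly_Mapping.lookup e i * C i) \<le> (\<Sum>i\<in>V. M * C i)"
      using e by (intro sum_mono mult_right_mono) (auto simp: box_def less_imp_le)
    also have "\<dots> < K * M"
    proof -
      have "0 < M" by (simp add: M_def)
      then show ?thesis
        unfolding sum_distrib_left[symmetric] K_def by (simp add: mult.commute)
    qed
    finally show "(\<Sum>i\<in>V. Poly_Mapping.lookup e i * C i) < K * M" .
  qed
  have "(K * M) ^ card W < M * M ^ card W"
    unfolding power_mult_distrib by (rule mult_strict_right_mono) (simp_all add: M_def)
  also have "\<dots> \<le> M ^ card V"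
    using assms(3) power_increasing[of "Suc (card W)" "card V" M] by (simp add: M_def)
  finally have less: "(K * M) ^ card W < M ^ card V" .
  have coeff: "Poly_Mapping.lookup (\<Sum>e\<in>box V M. Poly_Mapping.single e (u e)) k = u k"
    if "k \<in> box V M" for k and u :: "_ \<Rightarrow> 'a"
    using that finite_box[OF assms(1)] by (simp add: lookup_sum lookup_single when_def)
  have V: "(\<Sum>e\<in>box V M. Poly_Mapping.single e (u e)) \<in> polys_in V" for u :: "_ \<Rightarrow> 'a"
    by (intro polys_in_sum polys_in_single) (auto simp: box_def)
  have ev: "pc.ev g (\<Sum>e\<in>box V M. Poly_Mapping.single e (u e)) = (\<Sum>e\<in>box V M. cst (u e) * ?F e)"
    for u :: "_ \<Rightarrow> 'a"
    by (simp add: pc.ev_sum pc.ev_single)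
  show ?thesis
  \<comment> \<open>Linear dependence is a property of a set, so coinciding products are treated
    apart: there the difference of the two monomials is the relation.\<close>
  proof (cases "inj_on ?F (box V M)")
    case True
    have "card ?B \<le> (K * M) ^ card W"
      using card_image_le[OF finite_box[OF assms(2)]] by (simp add: card_box[OF assms(2), symmetric])
    then have "\<not> card (?F ` box V M) \<le> card ?B"
      using less True by (simp add: card_image card_box[OF assms(1)])
    then have "mpol_vs.dependent (?F ` box V M)"
      using mpol_vs.independent_span_bound[of ?B "?F ` box V M"] span finite_box[OF assms(2)] by blast
    then obtain u where u: "\<exists>v\<in>?F ` box V M. u v \<noteq> 0" "(\<Sum>v\<in>?F ` box V M. cst (u v) * v) = 0"
      using mpol_vs.dependent_finite[of "?F ` box V M"] finite_box[OF assms(1)] by auto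
    then obtain k where k: "k \<in> box V M" "u (?F k) \<noteq> 0" by auto
    let ?p = "\<Sum>e\<in>box V M. Poly_Mapping.single e (u (?F e))"
    have "pc.ev g ?p = 0"
      unfolding ev using u(2) by (simp add: sum.reindex[OF True])
    moreover have "?p \<noteq> 0"
      using coeff[OF k(1), of "\<lambda>e. u (?F e)"] k(2) by auto
    ultimately show ?thesis using V by (intro bexI[of _ ?p] conjI)
  next
    case False
    then obtain e e' where e: "e \<in> box V M" "e' \<in> box V M" "?F e = ?F e'" "e \<noteq> e'"
      by (auto simp: inj_on_def)
    let ?p = "Poly_Mapping.single e 1 - Poly_Mapping.single e' 1 :: 'a mpol"
    have "Poly_Mapping.lookup ?p e = 1" using e by (simp add: lookup_minus lookup_single when_def)
    then have "?p \<noteq> 0" by auto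
    moreover have "?p \<in> polys_in V"
      using e by (intro polys_in_diff polys_in_single) (auto simp: box_def)
    moreover have "pc.ev g ?p = 0" using e by (simp add: pc.ev_diff)
    ultimately show ?thesis by blast
  qed
qed

text \<open>As \<open>slice 1\<close> is zero, evaluation at the slices factors through setting y_1
  to 0, and that evaluation recovers the invariant.\<close>

lemma Zn_restrict_inj:
  fixes f :: "'a::field_char_0 mpol"
  assumes "f \<in> Zn n" and "pc.ev (\<lambda>i. if i = 1 then 0 else yv i) f = 0"
  shows "f = 0"
proof -
  have "to_rat f = fr.ev slice f"
    using assms(1) by (simp add: ev_slice)
  also have "\<dots> = fr.ev slice (pc.ev (\<lambda>i. if i = 1 then 0 else yv i) f)"
    unfolding fr.ev_comp by (rule fr.ev_cong[OF polys_in_UNIV]) (simp add: slice_def)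
  finally show ?thesis using assms(2) by (simp add: to_rat_eq_0_iff)
qed

lemma pc_ev_Zn:
  assumes "p \<in> polys_in V" and "\<And>i. i \<in> V \<Longrightarrow> g i \<in> Zn n"
  shows "pc.ev g p \<in> Zn n"
  using assms by (rule pc.ev_closed) (auto intro: Zn_add Zn_mult)

text \<open>Setting y_1 to 0 places the n + 1 invariants in n variables, where a relation exists.
  Its value at the original elements is itself an invariant, so it vanishes by
  \<open>Zn_restrict_inj\<close>.\<close>

lemma Zn_algebraic_dependence:
  fixes x :: "nat \<Rightarrow> 'a::field_char_0 mpol"
  assumes "n \<ge> 1" and x: "\<And>i. i \<le> n \<Longrightarrow> x i \<in> Zn n"
  shows "\<exists>p\<in>polys_in {..n}. p \<noteq> 0 \<and> pc.ev x p = 0"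
proof -
  let ?r = "\<lambda>i. if i = 1 then 0 else yv i :: 'a mpol"
  have "\<exists>p\<in>polys_in {..n}. p \<noteq> 0 \<and> pc.ev (\<lambda>i. pc.ev ?r (x i)) p = 0"
  proof (rule algebraic_dependence)
    show "card ({..n} - {1}) < card {..n}" using assms(1) by (intro psubset_card_mono) auto
    show "pc.ev ?r (x i) \<in> polys_in ({..n} - {1})" if "i \<in> {..n}" for i
      using x[of i] that by (intro pc_ev_in_polys_in[where V = "{..n}"]) (auto simp: Zn_eq)
  qed auto
  then obtain p where p: "p \<in> polys_in {..n}" "p \<noteq> 0" "pc.ev (\<lambda>i. pc.ev ?r (x i)) p = 0"
    by blast
  have "pc.ev x p = 0"
  proof (rule Zn_restrict_inj)
    show "pc.ev x p \<in> Zn n" using p(1) by (rule pc_ev_Zn) (simp add: x)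
    show "pc.ev ?r (pc.ev x p) = 0" unfolding pc.ev_comp by (rule p(3))
  qed
  then show ?thesis using p by blast
qed

subsection \<open>Chains of prime ideals\<close>

lemma split_variable:
  assumes "p \<in> polys_in (insert i V)"
  shows "\<exists>q r. q \<in> polys_in V \<and> r \<in> polys_in (insert i V) \<and> p = q + yv i * r"
  using assms
proof (induction p rule: polys_in_induct)
  case (cst c)
  show ?case by (intro exI[of _ "cst c"] exI[of _ 0]) simp
next
  case (yv j p)
  then obtain q r where qr: "q \<in> polys_in V" "r \<in> polys_in (insert i V)" "p = q + yv i * r" by blast
  show ?case
  proof (cases "j = i")
    case True
    then show ?thesis using yv by (intro exI[of _ 0] exI[of _ p]) simp
  next
    case False
    then show ?thesis using yv qr
      by (intro exI[of _ "yv j * q"] exI[of _ "yv j * r"]) (auto simp: algebra_simps intro!: polys_in_mult)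
  qed
next
  case (add p p')
  then obtain q r q' r' where "q \<in> polys_in V" "r \<in> polys_in (insert i V)" "p = q + yv i * r"
    "q' \<in> polys_in V" "r' \<in> polys_in (insert i V)" "p' = q' + yv i * r'" by blast
  then show ?case
    by (intro exI[of _ "q + q'"] exI[of _ "r + r'"]) (auto simp: algebra_simps intro!: polys_in_add)
qed

text \<open>The highest power of y_i dividing p is taken out. While the part free of y_i is zero,
  y_i is divided out, and a bound on the exponents of y_i decreases.\<close>

lemma lowest_term:
  fixes p :: "'a::field mpol"
  assumes "p \<in> polys_in (insert i V)" "p \<noteq> 0"
  shows "\<exists>a q r. q \<in> polys_in V \<and> q \<noteq> 0 \<and> r \<in> polys_in (insert i V) \<and> p = yv i ^ a * (q + yv i * r)"
proof -
  have "\<exists>a q r. q \<in> polys_in V \<and> q \<noteq> 0 \<and> r \<in> polys_in (insert i V) \<and> p = yv i ^ a * (q + yv i * r)"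
    if "p \<in> polys_in (insert i V)" "p \<noteq> 0" "\<forall>m\<in>Poly_Mapping.keys p. Poly_Mapping.lookup m i < N"
    for N and p :: "'a mpol"
    using that
  proof (induction N arbitrary: p)
    case 0
    then have "Poly_Mapping.keys p = {}" by auto
    then show ?case using 0 by (metis poly_mapping_eqI in_keys_iff empty_iff lookup_zero)
  next
    case (Suc N)
    from split_variable[OF Suc.prems(1)] obtain q r
      where qr: "q \<in> polys_in V" "r \<in> polys_in (insert i V)" "p = q + yv i * r" by blast
    show ?case
    proof (cases "q = 0")
      case True
      have "Poly_Mapping.lookup m i < N" if "m \<in> Poly_Mapping.keys r" for m
      proof -
        have "Poly_Mapping.single i 1 + m \<in> Poly_Mapping.keys p"
          using that lookup_single_mult[of "Poly_Mapping.single i 1" 1 r m]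
          by (simp add: qr True yv_def in_keys_iff)
        then have "Poly_Mapping.lookup (Poly_Mapping.single i 1 + m) i < Suc N"
          using Suc.prems(3) by blast
        then show ?thesis by (simp add: lookup_add)
      qed
      moreover have "r \<noteq> 0" using Suc.prems(2) qr True by auto
      ultimately obtain a q' r' where "q' \<in> polys_in V" "q' \<noteq> 0" "r' \<in> polys_in (insert i V)"
        "r = yv i ^ a * (q' + yv i * r')"
        using Suc.IH[OF qr(2)] by blast
      then show ?thesis
        using qr(3) True by (intro exI[of _ "Suc a"] exI[of _ q'] exI[of _ r']) (simp add: mult.assoc)
    next
      case False
      then show ?thesis using qr by (intro exI[of _ 0] exI[of _ q] exI[of _ r]) simp
    qed
  qed
  moreover have "\<forall>m\<in>Poly_Mapping.keys p. Poly_Mapping.lookup m i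
      < Suc (Max ((\<lambda>m. Poly_Mapping.lookup m i) ` Poly_Mapping.keys p))"
    by (simp add: less_Suc_eq_le)
  ultimately show ?thesis using assms by blast
qed

section \<open>The ring of invariants and the upper bound for chains\<close>

abbreviation Zn_ring :: "nat \<Rightarrow> 'a::field mpol ring" where
  "Zn_ring n \<equiv> ring_of_type_algebra\<lparr>carrier := Zn n\<rparr>"

lemma cring_Zn: "cring (Zn_ring n)"
proof (rule cringI)
  show "abelian_group (Zn_ring n)"
  proof (rule abelian_groupI)
    fix x assume "x \<in> carrier (Zn_ring n)"
    then show "\<exists>y\<in>carrier (Zn_ring n). y \<oplus>\<^bsub>Zn_ring n\<^esub> x = \<zero>\<^bsub>Zn_ring n\<^esub>"
      by (intro bexI[of _ "- x"]) (simp_all add: Zn_uminus)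
  qed (simp_all add: Zn_add add_ac)
  show "comm_monoid (Zn_ring n)"
    by (rule comm_monoidI) (simp_all add: Zn_mult mult_ac)
qed (simp add: distrib_right)

lemma a_inv_Zn: "p \<in> Zn n \<Longrightarrow> \<ominus>\<^bsub>Zn_ring n\<^esub> p = - p"
  by (rule abelian_group.minus_equality[OF ring.is_abelian_group[OF cring.axioms(1)[OF cring_Zn]]])
    (simp_all add: Zn_uminus)

lemma primeideal_ZnD:
  assumes "primeideal P (Zn_ring n)"
  shows "P \<subseteq> Zn n" and "0 \<in> P" and "1 \<notin> P"
    and "p \<in> P \<Longrightarrow> q \<in> P \<Longrightarrow> p - q \<in> P" and "p \<in> P \<Longrightarrow> q \<in> Zn n \<Longrightarrow> p * q \<in> P"
    and "p \<in> Zn n \<Longrightarrow> q \<in> Zn n \<Longrightarrow> p * q \<in> P \<Longrightarrow> p \<in> P \<or> q \<in> P"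
proof -
  interpret primeideal P "Zn_ring n" by fact
  show sub: "P \<subseteq> Zn n" using a_subset by simp
  show "0 \<in> P" using additive_subgroup.zero_closed[OF is_additive_subgroup] by simp
  show "1 \<notin> P" using one_imp_carrier I_notcarr by auto
  show "p * q \<in> P" if "p \<in> P" "q \<in> Zn n" using I_r_closed[of p q] that by simp
  show "p \<in> Zn n \<Longrightarrow> q \<in> Zn n \<Longrightarrow> p * q \<in> P \<Longrightarrow> p \<in> P \<or> q \<in> P"
    using I_prime by simp
  show "p - q \<in> P" if "p \<in> P" "q \<in> P"
  proof -
    have "\<ominus>\<^bsub>Zn_ring n\<^esub> q = - q"
      using sub that(2) by (intro a_inv_Zn) auto
    then have "- q \<in> P"
      using additive_subgroup.a_inv_closed[OF is_additive_subgroup that(2)] by (simp only:)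
    then show ?thesis
      using additive_subgroup.a_closed[OF is_additive_subgroup that(1), of "- q"] by simp
  qed
qed

text \<open>Descending induction on i. Write p = y_i^a (q + y_i r) with q nonzero in later
  variables. If p(x) were in P_i, primality would cancel the powers of x_i, which is not in P_i;
  since x_i lies in P_(i+1), this would put q(x) into P_(i+1), against the induction
  hypothesis.\<close>

lemma independent_modulo_chain:
  fixes P :: "nat \<Rightarrow> 'a::field_char_0 mpol set"
  assumes prime: "\<And>i. i \<le> Suc n \<Longrightarrow> primeideal (P i) (Zn_ring n)"
    and x: "\<And>i. i \<le> n \<Longrightarrow> x i \<in> P (Suc i) - P i" and sub: "\<And>i. i \<le> n \<Longrightarrow> P i \<subseteq> P (Suc i)"
    and "i \<le> Suc n" "p \<in> polys_in {i..n}" "p \<noteq> 0"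
  shows "pc.ev x p \<notin> P i"
  using assms(4-6)
proof (induction i arbitrary: p rule: inc_induct)
  case base
  \<comment> \<open>At the top the set of variables is empty, so p is a nonzero constant, hence a
    unit outside the prime.\<close>
  from base(1) obtain c where c: "p = cst c"
  proof (induction p rule: polys_in_induct)
    case (add p q)
    then show ?case by (metis cst_simps(3))
  qed auto
  note P = primeideal_ZnD[OF prime[OF order_refl]]
  show ?case
  proof
    assume "pc.ev x p \<in> P (Suc n)"
    then have "cst c * cst (1 / c) \<in> P (Suc n)"
      using P(5)[of "cst c" "cst (1 / c)"] c by (simp del: cst_simps)
    moreover have "c \<noteq> 0" using c base by auto
    ultimately have "cst 1 \<in> P (Suc n)"
      by (simp flip: cst_simps(4))
    then show False using P(3) by simp
  qed
next
  case (step i)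
  have i: "i \<le> n" using step by simp
  have xZ: "x j \<in> Zn n" if "j \<le> n" for j
    using x[OF that] primeideal_ZnD(1)[OF prime[of "Suc j"]] that by auto
  have "{i..n} = insert i {Suc i..n}" using i by auto
  then obtain a q r where p: "q \<in> polys_in {Suc i..n}" "q \<noteq> 0" "r \<in> polys_in {i..n}"
    "p = yv i ^ a * (q + yv i * r)"
    using lowest_term[of p i "{Suc i..n}"] step by auto
  have Z: "pc.ev x q \<in> Zn n" "pc.ev x r \<in> Zn n" "x i \<in> Zn n"
    using pc_ev_Zn[OF p(1)] pc_ev_Zn[OF p(3)] xZ i by auto
  note P = primeideal_ZnD[OF prime[of i]] and P' = primeideal_ZnD[OF prime[of "Suc i"]]
  show ?case
  proof
    assume "pc.ev x p \<in> P i"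
    then have "x i ^ a * (pc.ev x q + x i * pc.ev x r) \<in> P i"
      by (simp add: p pc.ev_hom)
    then have "pc.ev x q + x i * pc.ev x r \<in> P i"
    proof (induction a)
      case (Suc a)
      have "x i ^ k \<in> Zn n" for k by (induction k) (simp_all add: Zn_mult Z)
      then have "x i ^ a * (pc.ev x q + x i * pc.ev x r) \<in> P i"
        using P(6)[of "x i" "x i ^ a * (pc.ev x q + x i * pc.ev x r)"] Suc.prems x[OF i] i Z
        by (simp add: mult.assoc Zn_mult Zn_add)
      then show ?case by (rule Suc.IH)
    qed simp
    then have "pc.ev x q + x i * pc.ev x r \<in> P (Suc i)" using sub i by blast
    moreover have "x i * pc.ev x r \<in> P (Suc i)" using P'(5) x[OF i] i Z by auto
    ultimately have "pc.ev x q \<in> P (Suc i)" using P'(4) i by fastforce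
    then show False using step.IH[OF p(1,2)] by simp
  qed
qed

section \<open>A chain of primes of length n\<close>

definition Zn_kernel :: "nat \<Rightarrow> (nat \<Rightarrow> 'a mpol) \<Rightarrow> 'a::field mpol set" where
  "Zn_kernel n g = {f \<in> Zn n. pc.ev g f = 0}"

text \<open>Substitution maps the invariants to an integral domain and sends 1 to 1, so its kernel
  is a proper prime ideal.\<close>

lemma primeideal_Zn_kernel: "primeideal (Zn_kernel n g) (Zn_ring n)"
proof (rule primeidealI)
  show "ideal (Zn_kernel n g) (Zn_ring n)"
  proof (rule idealI[OF cring.axioms(1)[OF cring_Zn]])
    show "subgroup (Zn_kernel n g) (add_monoid (Zn_ring n))"
    proof (rule group.subgroupI[OF abelian_group.a_group[OF ring.is_abelian_group[OF cring.axioms(1)[OF cring_Zn]]]])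
      fix f assume "f \<in> Zn_kernel n g"
      then show "inv\<^bsub>add_monoid (Zn_ring n)\<^esub> f \<in> Zn_kernel n g"
        using a_inv_Zn[of f n] by (simp add: a_inv_def Zn_kernel_def Zn_uminus pc.ev_uminus)
    qed (auto simp: Zn_kernel_def Zn_add pc.ev_hom intro!: exI[of _ 0])
  qed (auto simp: Zn_kernel_def Zn_mult pc.ev_hom)
  show "carrier (Zn_ring n) \<noteq> Zn_kernel n g"
    using Zn_1[of n] by (auto simp: Zn_kernel_def set_eq_iff intro!: exI[of _ 1])
qed (auto simp: cring_Zn Zn_kernel_def pc.ev_hom)

text \<open>After inverting \<open>y\<^sub>0\<close> the invariants become a Laurent polynomial ring in \<open>y\<^sub>0, w\<^sub>2, \<dots>, w\<^sub>n\<close>;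
  setting \<open>y\<^sub>0 = 1\<close>, \<open>y\<^sub>1 = 0\<close> sends \<open>w\<^sub>m\<close> to \<open>y\<^sub>m\<close>, so the kernels of the following substitutions are
  the contractions of \<open>(0) \<subset> (y\<^sub>0 - 1) \<subset> (y\<^sub>0 - 1, w\<^sub>2) \<subset> \<dots>\<close>.\<close>

definition chain_subst :: "nat \<Rightarrow> nat \<Rightarrow> 'a::field mpol" where
  "chain_subst i j = (if i = 0 then yv j else if j = 0 then 1 else if j \<le> i then 0 else yv j)"

text \<open>With y_1 sent to 0 only the term y_0^(m-1) y_m survives, and y_0 is sent to 1.\<close>

lemma ev_ws:
  assumes "m \<ge> 2" "g 0 = 1" "g 1 = 0"
  shows "pc.ev g (ws m) = g m"
proof -
  have "(\<Sum>i<m. (cst ((-1) ^ i / of_nat (fact i)) * g 1 ^ i * g (m - i))) = (\<Sum>i<m. if i = 0 then g m else 0)"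
    using assms by (intro sum.cong) (auto simp: power_0_left)
  then show ?thesis
    using assms by (simp add: ws_def pc.ev_hom power_0_left)
qed

text \<open>Each substitution factors through the preceding one, which gives the inclusion. The
  first step is strict by y_0 - 1, the later ones by w_(i+1), sent to y_(i+1) by one substitution
  and to 0 by the next.\<close>

lemma chain_strict:
  assumes "i < n"
  shows "Zn_kernel n (chain_subst i) \<subset> (Zn_kernel n (chain_subst (Suc i)) :: 'a::field_char_0 mpol set)"
proof (rule psubsetI)
  let ?s = "chain_subst :: nat \<Rightarrow> nat \<Rightarrow> 'a mpol"
  have "pc.ev (?s (Suc i)) f = pc.ev (?s (Suc i)) (pc.ev (?s i) f)" for f
    unfolding pc.ev_comp by (rule pc.ev_cong[OF polys_in_UNIV]) (simp add: chain_subst_def)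
  then show "Zn_kernel n (?s i) \<subseteq> Zn_kernel n (?s (Suc i))"
    by (auto simp: Zn_kernel_def) (metis pc.ev_0)
  show "Zn_kernel n (?s i) \<noteq> Zn_kernel n (?s (Suc i))"
  proof (cases "i = 0")
    case True
    have "yv 0 - 1 \<in> Zn_kernel n (?s (Suc i))"
      by (simp add: Zn_kernel_def Zn_diff pc.ev_hom chain_subst_def)
    moreover have "yv 0 - 1 \<notin> Zn_kernel n (?s i)"
    proof
      assume "yv 0 - 1 \<in> Zn_kernel n (?s i)"
      \<comment> \<open>The substitution with index 0 is the identity on variables, so the kernel
        condition says y_0 - 1 = 0; its derivative in y_0 is 1.\<close>
      then have "pdiff 0 (yv 0 - 1 :: 'a mpol) = 0"
        by (simp add: Zn_kernel_def pc.ev_hom chain_subst_def True derivationD[OF derivation_pdiff])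
      then show False by (simp add: derivationD[OF derivation_pdiff] pdiff_yv)
    qed
    ultimately show ?thesis by blast
  next
    case False
    then have "pc.ev (?s i) (ws (Suc i)) = yv (Suc i)" "pc.ev (?s (Suc i)) (ws (Suc i)) = 0"
      by (subst ev_ws; simp add: chain_subst_def)+
    moreover have "(ws (Suc i) :: 'a mpol) \<in> Zn n"
      using assms by (intro ws_in_Zn) auto
    ultimately have "ws (Suc i) \<in> Zn_kernel n (?s (Suc i)) - Zn_kernel n (?s i)"
      by (simp add: Zn_kernel_def)
    then show ?thesis by blast
  qed
qed

text \<open>A longer chain would make n + 1 invariants independent modulo its smallest prime,
  whereas their algebraic relation evaluates to 0, which lies in that prime. The kernels of
  \<open>chain_subst\<close> attain the bound.\<close>

theorem krull_dim_Zn: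
  assumes "n \<ge> 1"
  shows "krull_dim (Zn_ring n :: 'a::field_char_0 mpol ring) = enat n"
proof (rule antisym)
  show "krull_dim (Zn_ring n :: 'a mpol ring) \<le> enat n"
    unfolding krull_dim_def
  proof (rule Sup_least, clarify)
    fix k and P :: "nat \<Rightarrow> 'a mpol set"
    assume prime: "\<forall>i\<le>k. primeideal (P i) (Zn_ring n)" and chain: "\<forall>i<k. P i \<subset> P (Suc i)"
    show "enat k \<le> enat n"
    proof (rule ccontr)
      assume "\<not> enat k \<le> enat n"
      then have k: "Suc n \<le> k" by simp
      have "\<exists>x. x \<in> P (Suc i) - P i" if "i \<le> n" for i
        using chain k that by (meson Suc_le_lessD less_le_trans le_imp_less_Suc psubset_imp_ex_mem)
      then obtain x where x: "\<And>i. i \<le> n \<Longrightarrow> x i \<in> P (Suc i) - P i" by metis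
      have pr: "primeideal (P i) (Zn_ring n)" if "i \<le> Suc n" for i
        using prime k that by auto
      have "x i \<in> Zn n" if "i \<le> n" for i
        using x[OF that] primeideal_ZnD(1)[OF pr[of "Suc i"]] that by auto
      then obtain p where p: "p \<in> polys_in {..n}" "p \<noteq> 0" "pc.ev x p = 0"
        using Zn_algebraic_dependence[OF assms] by blast
      have sub: "P i \<subseteq> P (Suc i)" if "i \<le> n" for i
        using chain k that by (simp add: psubset_imp_subset)
      have "pc.ev x p \<notin> P 0"
        using pr x sub by (rule independent_modulo_chain[where n = n]) (use p in \<open>auto simp: atLeast0AtMost\<close>)
      then show False using p(3) primeideal_ZnD(2)[OF pr[of 0]] by simp
    qed
  qed
  show "enat n \<le> krull_dim (Zn_ring n :: 'a mpol ring)"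
    unfolding krull_dim_def
  proof (intro Sup_upper CollectI exI conjI)
    show "\<forall>i\<le>n. primeideal (Zn_kernel n (chain_subst i) :: 'a mpol set) (Zn_ring n)"
      by (simp add: primeideal_Zn_kernel)
    show "\<forall>i<n. Zn_kernel n (chain_subst i) \<subset> (Zn_kernel n (chain_subst (Suc i)) :: 'a mpol set)"
      using chain_strict by blast
  qed simp
qed

text \<open>The first group of conjuncts secures the identification behind the rest:
  \<open>pbw n\<close> embeds the polynomial ring in the enveloping algebra and carries
  \<open>Zn n\<close> onto the whole center.\<close>

theorem theorem1p1:
  fixes n :: nat
  assumes "n \<ge> 1"
  shows
    "((pbw n :: 'a::field_char_0 mpol \<Rightarrow> _)
        \<in> ring_hom (ring_of_type_algebra\<lparr>carrier := ypolys n\<rparr>) (fil_uea n)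
      \<and> inj_on (pbw n) (ypolys n :: 'a mpol set)
      \<and> pbw n ` (Zn n :: 'a mpol set) = ring_center (fil_uea n))
     \<and> krull_dim (ring_of_type_algebra\<lparr>carrier := (Zn n :: 'a mpol set)\<rparr>) = enat n
     \<and> (frac_field_of (Zn n :: 'a mpol set) = gen_subfield (to_rat ` zs n ` {1..n})
        \<and> gen_subfield (to_rat ` zs n ` {1..n}) = gen_subfield (to_rat ` ws ` {1..n} :: 'a mpol fract set))
     \<and> (to_rat ` (Zn n :: 'a mpol set)
          \<subseteq> gen_subalgebra (insert (inverse (to_rat (yv 0))) (to_rat ` zs n ` {1..n}))
        \<and> to_rat ` (Zn n :: 'a mpol set)
          \<subseteq> gen_subalgebra (insert (inverse (to_rat (yv 0))) (to_rat ` ws ` {1..n})))"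
proof -
  have y0: "yv 0 \<in> (zs n ` {1..n} :: 'a mpol set)" "yv 0 \<in> (ws ` {1..n} :: 'a mpol set)"
    using assms by (auto simp: zs_def ws_def intro!: image_eqI[of _ _ 1])
  have "frac_field_of (Zn n :: 'a mpol set) = gen_subfield (to_rat ` zs n ` {1..n})"
    by (rule frac_field_of_Zn[OF _ y0(1) Zn_subset_zs[OF assms]]) (auto intro: zs_in_Zn)
  moreover have "frac_field_of (Zn n :: 'a mpol set) = gen_subfield (to_rat ` ws ` {1..n})"
    by (rule frac_field_of_Zn[OF _ y0(2) Zn_subset_ws[OF assms]]) (auto intro: ws_in_Zn)
  ultimately show ?thesis
    using pbw_ring_hom pbw_inj pbw_Zn[OF assms] krull_dim_Zn[OF assms] Zn_subset_zs[OF assms] Zn_subset_ws[OF assms]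
    by auto
qed

end
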